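(* Let $d=2$ and put $\mathcal{G}=\mathcal{F}^{\mathrm L}_{\mathrm{INV}}\cap\mathcal{F}^{\mathrm L}(2^{1/4})$. Suppose there exist a pilot estimator $\hat{\boldsymbol f}_n^{(1)}:I^2\to I^2$, constants $C>0$, $\alpha>0$ and a sequence $\delta_n\searrow0$ such that, for $\boldsymbol f_*\in\mathcal{G}$ and all sufficiently large $n$, $$\mathbb{P}\Big(\|\hat{\boldsymbol f}_n^{(1)}-\boldsymbol f_*\|_{L^\infty}\le C\,n^{-1/(2+d)}(\log n)^{\alpha}\Big)\ge 1-\delta_n$$ (uniformly over $\boldsymbol f_*\in\mathcal{G}$). Then, for any $\beta>0$, there exists $\overline{C}\in(0,\infty)$ such that $$\inf_{\bar{\boldsymbol f}_n}\ \sup_{\boldsymbol f_*\in\mathcal{G}}\ \mathsf{R}^{\ddagger}_{\mathrm{INV}}(\bar{\boldsymbol f}_n,\boldsymbol f_* )\ \le\ \overline{C}\,n^{-2/(2+d)}(\log n)^{2\alpha+2\beta}$$ for any sufficiently large $n$, where the infimum is over all measurable estimators depending on $\mathcal{D}_n$.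
   Context: Let $d=2$ and $I=[-1,1]$. $\mathcal{F}^{\mathrm L}_{\mathrm{INV}}$ is the set of bijections $\boldsymbol f:I^2\to I^2$ that are bi-Lipschitz, i.e. there is some $L\ge 1$ with $L^{-1}\|\boldsymbol x-\boldsymbol x'\|_2\le\|\boldsymbol f(\boldsymbol x)-\boldsymbol f(\boldsymbol x')\|_2\le L\|\boldsymbol x-\boldsymbol x'\|_2$ for all $\boldsymbol x,\boldsymbol x'\in I^2$. For $L>0$, $\mathcal{F}^{\mathrm L}(L)=\{\boldsymbol f:I^2\to I^2\mid \boldsymbol f,\boldsymbol f^{-1}\text{ are }L\text{-Lipschitz}\}$ (with respect to $\|\cdot\|_2$). Model: $\mathcal{D}_n=\{(\boldsymbol X_i,\boldsymbol Y_i)\}_{i=1}^n\subset I^2\times\mathbb{R}^2$ are i.i.d. with $\boldsymbol Y_i=\boldsymbol f_*(\boldsymbol X_i)+\boldsymbol\varepsilon_i$, $\boldsymbol\varepsilon_i\sim N_2(\boldsymbol 0,\sigma^2\boldsymbol I_2)$ i.i.d., $\sigma^2>0$ fixed, $\boldsymbol f_*$ the true function. The (fixed) marginal distribution $P_{\boldsymbol X}$ of $\boldsymbol X_i$ has a density that is positive and bounded on $I^2$. $\mathbb{E}_n$ is expectation with respect to $\mathcal{D}_n$. An estimator $\bar{\boldsymbol f}_n$ is a measurable function of $\mathcal{D}_n$ with values in (measurable) maps $I^2\to\mathbb{R}^2$. Its quasi-inverse is: $\bar{\boldsymbol f}_n^{\ddagger}(\boldsymbol y)=\boldsymbol x$ if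 $\boldsymbol x\in I^2$ is the unique point with $\bar{\boldsymbol f}_n(\boldsymbol x)=\boldsymbol y$, and $\bar{\boldsymbol f}_n^{\ddagger}(\boldsymbol y)=\boldsymbol c$ otherwise, where $\boldsymbol c\in\mathbb{R}^2\setminus I^2$ is a fixed vector. $\|\boldsymbol f\|_{L^\infty}=\max_j\sup_{\boldsymbol x}|f_j(\boldsymbol x)|$, $\|\boldsymbol f\|_{L^2(P_{\boldsymbol X})}=(\sum_{j=1}^2\int|f_j|^2\,dP_{\boldsymbol X})^{1/2}$. The $L^2$-risk for the inverse is $$\mathsf{R}^{\ddagger}_{\mathrm{INV}}(\bar{\boldsymbol f}_n,\boldsymbol f_* )=\mathbb{E}_n\Big[\|\bar{\boldsymbol f}_n^{\ddagger}-\boldsymbol f_*^{-1}\|_{L^2(P_{\boldsymbol X})}^2\Big].$$ *)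

theory Defs
  imports "HOL-Probability.Probability"
begin

section \<open>Function classes on the square\<close>

definition square :: "(real^2) set" where
  "square = cbox (- 1) 1"

lemma mem_square: "x \<in> square \<longleftrightarrow> (\<forall>j. - 1 \<le> x $ j \<and> x $ j \<le> 1)"
  by (simp add: square_def mem_box_cart)

text \<open>Maps on the square are represented by total functions of which only the values on
  \<^term>\<open>square\<close> matter: every notion below ignores the values outside \<^term>\<open>square\<close>.\<close>

definition FL_INV :: "(real^2 \<Rightarrow> real^2) set" where
  "FL_INV = {f. bij_betw f square square \<and>
     (\<exists>L\<ge>1. \<forall>x\<in>square. \<forall>x'\<in>square.
        norm (x - x') / L \<le> norm (f x - f x') \<and> norm (f x - f x') \<le> L * norm (x - x'))}"

definition FL :: "real \<Rightarrow> (real^2 \<Rightarrow> real^2) set" where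
  "FL L = {f. bij_betw f square square \<and>
     L-lipschitz_on square f \<and> L-lipschitz_on square (the_inv_into square f)}"


section \<open>The regression model\<close>

definition P_X :: "(real^2 \<Rightarrow> real) \<Rightarrow> (real^2) measure" where
  "P_X p = density (restrict_space lborel square) (\<lambda>x. ennreal (p x))"

definition noise :: "real \<Rightarrow> (real^2) measure" where
  "noise \<sigma> = density lborel (\<lambda>e. ennreal (\<Prod>j\<in>UNIV. normal_density 0 \<sigma> (e $ j)))"

abbreviation obs_space :: "((real^2) \<times> (real^2)) measure" where
  "obs_space \<equiv> restrict_space borel square \<Otimes>\<^sub>M borel"

abbreviation sample_space :: "nat \<Rightarrow> (nat \<Rightarrow> (real^2) \<times> (real^2)) measure" where
  "sample_space n \<equiv> PiM {..<n} (\<lambda>_. obs_space)"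

definition obs_law :: "(real^2 \<Rightarrow> real) \<Rightarrow> real \<Rightarrow> (real^2 \<Rightarrow> real^2) \<Rightarrow> ((real^2) \<times> (real^2)) measure" where
  "obs_law p \<sigma> f = distr (P_X p \<Otimes>\<^sub>M noise \<sigma>) obs_space (\<lambda>(x, e). (x, f x + e))"

definition sample_law ::
  "(real^2 \<Rightarrow> real) \<Rightarrow> real \<Rightarrow> nat \<Rightarrow> (real^2 \<Rightarrow> real^2) \<Rightarrow> (nat \<Rightarrow> (real^2) \<times> (real^2)) measure" where
  "sample_law p \<sigma> n f = PiM {..<n} (\<lambda>_. obs_law p \<sigma> f)"


section \<open>Estimators and risk\<close>

text \<open>Measurability of an estimator is joint measurability in the data and the argument.\<close>

definition estimators :: "nat \<Rightarrow> ((nat \<Rightarrow> (real^2) \<times> (real^2)) \<Rightarrow> real^2 \<Rightarrow> real^2) set" where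
  "estimators n =
     {g. (\<lambda>(D, x). g D x) \<in> sample_space n \<Otimes>\<^sub>M restrict_space borel square \<rightarrow>\<^sub>M borel}"

definition quasi_inverse :: "real^2 \<Rightarrow> (real^2 \<Rightarrow> real^2) \<Rightarrow> real^2 \<Rightarrow> real^2" where
  "quasi_inverse c g y =
     (if \<exists>!x. x \<in> square \<and> g x = y then THE x. x \<in> square \<and> g x = y else c)"

definition Linf_norm :: "(real^2 \<Rightarrow> real^2) \<Rightarrow> ennreal" where
  "Linf_norm f = Max ((\<lambda>j. SUP x\<in>square. ennreal \<bar>f x $ j\<bar>) ` UNIV)"

definition L2_norm_sq :: "(real^2) measure \<Rightarrow> (real^2 \<Rightarrow> real^2) \<Rightarrow> ennreal" where
  "L2_norm_sq P f = (\<Sum>j\<in>UNIV. \<integral>\<^sup>+ x. ennreal (\<bar>f x $ j\<bar>\<^sup>2) \<partial>P)"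

text \<open>The quasi-inverse of a jointly Borel estimator is only universally measurable in general
  (its domain of definition is coanalytic). For such integrands the value of
  \<^const>\<open>nn_integral\<close> is the integral with respect to the completed measure.\<close>

definition inverse_risk ::
  "(real^2 \<Rightarrow> real) \<Rightarrow> real \<Rightarrow> real^2 \<Rightarrow> nat
    \<Rightarrow> ((nat \<Rightarrow> (real^2) \<times> (real^2)) \<Rightarrow> real^2 \<Rightarrow> real^2) \<Rightarrow> (real^2 \<Rightarrow> real^2) \<Rightarrow> ennreal" where
  "inverse_risk p \<sigma> c n g f =
     (\<integral>\<^sup>+ D. L2_norm_sq (P_X p) (\<lambda>y. quasi_inverse c (g D) y - the_inv_into square f y)
        \<partial>sample_law p \<sigma> n f)"

text \<open>The event below involves a supremum over uncountably many points, so in general it belongs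
  only to the completed \<open>\<sigma>\<close>-algebra.\<close>

definition Linf_error_prob ::
  "(real^2 \<Rightarrow> real) \<Rightarrow> real \<Rightarrow> nat
    \<Rightarrow> ((nat \<Rightarrow> (real^2) \<times> (real^2)) \<Rightarrow> real^2 \<Rightarrow> real^2) \<Rightarrow> (real^2 \<Rightarrow> real^2) \<Rightarrow> real \<Rightarrow> real" where
  "Linf_error_prob p \<sigma> n g f r =
     measure (completion (sample_law p \<sigma> n f))
       {D \<in> space (sample_law p \<sigma> n f). Linf_norm (\<lambda>x. g D x - f x) \<le> ennreal r}"

end

theory Submission
  imports Defs "HOL-Real_Asymp.Real_Asymp"
begin

text \<open>
  The failure probability of the pilot may decay arbitrarily slowly, so the pilot itself has no useful
  risk. It is used only through what its existence says about the design. Let \<open>r\<close> be its rate.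
  Perturbing the identity by a bump of height \<open>3 r\<close> supported in a cell of side comparable to
  \<open>r\<close> stays in the class, and the pilot tells the two functions apart. The chi-square divergence
  between the two Gaussian sample laws is therefore bounded below, which forces
  \<open>n r\<^sup>2 P(cell) \<ge> \<sigma>\<^sup>2 / 36\<close> for every such cell.

  Hence the variance \<open>1 / (n P(cell))\<close> of the inverse-probability-weighted mean of the observations
  in a cell is at most a multiple of \<open>r\<^sup>2\<close>, and so is its squared bias. Fitting these cell means by
  least squares within a finite net of the class gives an invertible estimator whose inverse has
  squared risk \<open>O(r\<^sup>2)\<close>.
\<close>

section \<open>Bi-Lipschitz bijections of the square\<close>

text \<open>On its failure event the pilot's inverse can be off by a constant, so bounding its risk
  by \<open>r\<^sup>2\<close> would require \<open>\<delta> n\<close> to be of that order; all that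
  can be drawn from the hypothesis is \<open>\<delta> n < 1/4\<close> for large n. The density, in
  turn, is positive but may come arbitrarily close to 0, so no lower bound on cell masses is
  available beforehand; the two-point argument supplies one at exactly the scale that is required.

  The scale is a balance. A cell must contain a bump of height \<open>3 * r\<close> and slope 1/10,
  hence have half-width at least \<open>30 * r\<close>; half-width at most \<open>60 * r\<close>
  keeps the bias within a multiple of r. With \<open>m\<^sup>2\<close> cells, each contributing
  squared error of order \<open>r\<^sup>2\<close>, the total error of the cell means is of constant
  order, and the area factor \<open>1 / m\<^sup>2\<close> of a cell brings the risk back to
  \<open>r\<^sup>2\<close>.

  The least-squares fit is controlled by the triangle inequality alone, so no entropy of the net
  enters the bound. The net lies inside the class: the fitted map is a bijection of the square, its
  quasi-inverse is a true inverse, and inverse errors reduce to forward errors through the Lipschitz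
  bound. The design law is fixed, so an estimator may divide by exact cell masses.\<close>

lemma quarter_root_two_bounds:
  shows "11/10 \<le> (2::real) powr (1/4)" "10/9 \<le> (2::real) powr (1/4)" "(2::real) powr (1/4) \<le> 2"
proof -
  have *: "x \<le> (2::real) powr (1/4)" if "0 < x" "x^4 \<le> 2" for x :: real
  proof -
    have "x = (x powr 4) powr (1/4)" using that(1) by (simp only: powr_powr) simp
    also have "\<dots> \<le> 2 powr (1/4)" using that by (intro powr_mono2) auto
    finally show ?thesis .
  qed
  \<comment> \<open>A perturbation of the identity with Lipschitz constant 1/10 has constant 11/10,
    and its inverse has constant \<open>1 / (1 - 1/10) = 10/9\<close>. Both fourth powers stay below
    2.\<close>
  show "11/10 \<le> (2::real) powr (1/4)" "10/9 \<le> (2::real) powr (1/4)"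
    by (intro *; simp add: power4_eq_xxxx)+
  have "(2::real) powr (1/4) \<le> 2 powr 1" by (intro powr_mono) auto
  then show "(2::real) powr (1/4) \<le> 2" by simp
qed

abbreviation bilipschitz_maps :: "(real^2 \<Rightarrow> real^2) set" where
  "bilipschitz_maps \<equiv> FL_INV \<inter> FL (2 powr (1/4))"

text \<open>Distances change by a factor between 9/10 and 11/10, which yields injectivity and both
  Lipschitz bounds. Surjectivity is Banach's fixed point theorem for the contraction sending x to
  \<open>y - u x\<close>.\<close>

lemma perturbed_identity_in_bilipschitz_maps:
  fixes u :: "real^2 \<Rightarrow> real^2"
  assumes lip: "\<And>x y. norm (u x - u y) \<le> norm (x - y) / 10"
    and supp: "\<And>x. x \<notin> square \<Longrightarrow> u x = 0"
    and into: "\<And>x. x \<in> square \<Longrightarrow> x + u x \<in> square"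
  shows "(\<lambda>x. x + u x) \<in> bilipschitz_maps"
proof -
  let ?f = "\<lambda>x. x + u x"
  have upper: "norm (?f x - ?f y) \<le> 11/10 * norm (x - y)" for x y
  proof -
    have "norm (?f x - ?f y) = norm ((x - y) + (u x - u y))" by (simp add: algebra_simps)
    also have "\<dots> \<le> norm (x - y) + norm (u x - u y)" by (rule norm_triangle_ineq)
    finally show ?thesis using lip[of x y] by simp
  qed
  have lower: "9/10 * norm (x - y) \<le> norm (?f x - ?f y)" for x y
  proof -
    have "norm (x - y) - norm (u y - u x) \<le> norm ((x - y) - (u y - u x))" by (rule norm_triangle_ineq2)
    also have "\<dots> = norm (?f x - ?f y)" by (simp add: algebra_simps)
    finally show ?thesis using lip[of y x] by (simp add: norm_minus_commute)
  qed
  have inj: "inj_on ?f square"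
  proof (rule inj_onI)
    fix x y assume "?f x = ?f y"
    then have "norm (?f x - ?f y) = 0" by simp
    then show "x = y" using lower[of x y] norm_ge_zero[of "x - y"] by (simp del: norm_ge_zero)
  qed
  have surj: "y \<in> ?f ` square" if y: "y \<in> square" for y
  proof -
    have "\<exists>!x. x \<in> UNIV \<and> y - u x = x"
    proof (rule Banach_fix[where c="1/10"])
      fix x z show "dist (y - u x) (y - u z) \<le> 1/10 * dist x z"
        using lip by (simp add: dist_norm norm_minus_commute)
    qed (auto simp: complete_UNIV)
    then obtain x where x: "y - u x = x" by blast
    \<comment> \<open>The contraction acts on the whole plane, so its fixed point must still be
      located: outside the square \<open>u x = 0\<close> would force \<open>x = y\<close>, a point
      of the square.\<close>
    have "x \<in> square"
      using supp[of x] x y by (cases "x \<in> square") auto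
    moreover have "?f x = y" using x by (simp add: algebra_simps)
    ultimately show ?thesis by blast
  qed
  have bij: "bij_betw ?f square square"
    unfolding bij_betw_def using inj surj into by auto
  have "?f \<in> FL_INV"
    unfolding FL_INV_def
  proof (intro CollectI conjI exI[of _ "2::real"] ballI)
    fix x y :: "real^2"
    show "norm (x - y) / 2 \<le> norm (?f x - ?f y)"
      using lower[of x y] norm_ge_zero[of "x - y"] by linarith
    show "norm (?f x - ?f y) \<le> 2 * norm (x - y)"
      using upper[of x y] norm_ge_zero[of "x - y"] by linarith
  qed (use bij in auto)
  moreover have "?f \<in> FL (2 powr (1/4))"
    unfolding FL_def
  proof (intro CollectI conjI lipschitz_onI)
    fix x y :: "real^2"
    have "norm (?f x - ?f y) \<le> 11/10 * norm (x - y)" by (rule upper)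
    also have "\<dots> \<le> 2 powr (1/4) * norm (x - y)"
      using quarter_root_two_bounds by (intro mult_right_mono) auto
    finally show "dist (?f x) (?f y) \<le> 2 powr (1/4) * dist x y" by (simp add: dist_norm)
  next
    fix y z assume yz: "y \<in> square" "z \<in> square"
    let ?i = "the_inv_into square ?f"
    have fi: "?f (?i y) = y" "?f (?i z) = z"
      using yz bij by (auto intro!: f_the_inv_into_f_bij_betw[of ?f square square])
    have "norm (?i y - ?i z) \<le> 10/9 * norm (y - z)"
      using lower[of "?i y" "?i z"] unfolding fi by simp
    also have "\<dots> \<le> 2 powr (1/4) * norm (y - z)"
      using quarter_root_two_bounds by (intro mult_right_mono) auto
    finally show "dist (?i y) (?i z) \<le> 2 powr (1/4) * dist y z" by (simp add: dist_norm)
  qed (use bij in auto)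
  ultimately show ?thesis by blast
qed

lemma id_in_bilipschitz_maps: "(\<lambda>x. x) \<in> bilipschitz_maps"
  using perturbed_identity_in_bilipschitz_maps[of "\<lambda>x. 0"] by simp

text \<open>The closed ball of the maximum norm. Grid cells take this form, so a bump placed at the
  center of a cell can be compared directly with the mass of that cell.\<close>

definition box_around :: "real^2 \<Rightarrow> real \<Rightarrow> (real^2) set" where
  "box_around t h = {x. \<forall>j. \<bar>x $ j - t $ j\<bar> \<le> h}"

text \<open>The displacement is a cone of height \<open>3 * r\<close> and slope 1/10. It vanishes
  outside the Euclidean ball of radius \<open>30 * r\<close> about t, and that ball lies in the
  box.\<close>

lemma bump_in_bilipschitz_maps:
  assumes r: "0 \<le> r" "30 * r \<le> h" and box: "box_around t h \<subseteq> square"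
  shows "(\<lambda>x. x + max 0 (3 * r - norm (x - t) / 10) *\<^sub>R axis j 1) \<in> bilipschitz_maps"
proof (rule perturbed_identity_in_bilipschitz_maps)
  let ?b = "\<lambda>x. max 0 (3 * r - norm (x - t) / 10)"
  have ball: "x \<in> square" if "norm (x - t) \<le> 30 * r" for x
  proof -
    have "x \<in> box_around t h" unfolding box_around_def
    proof (intro CollectI allI)
      fix i
      have "\<bar>(x - t) $ i\<bar> \<le> norm (x - t)" by (rule component_le_norm_cart)
      then show "\<bar>x $ i - t $ i\<bar> \<le> h" using that r by simp
    qed
    then show ?thesis using box by blast
  qed
  fix x y :: "real^2"
  have "norm (?b x *\<^sub>R axis j 1 - ?b y *\<^sub>R (axis j 1 :: real^2)) = \<bar>?b x - ?b y\<bar>"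
    by (simp add: scaleR_diff_left[symmetric] norm_axis_1 del: scaleR_diff_left)
  also have "\<dots> \<le> \<bar>norm (x - t) - norm (y - t)\<bar> / 10" by (auto simp: max_def abs_if)
  also have "\<dots> \<le> norm (x - y) / 10"
    using norm_triangle_ineq3[of "x - t" "y - t"] by simp
  finally show "norm (?b x *\<^sub>R axis j 1 - ?b y *\<^sub>R (axis j 1 :: real^2)) \<le> norm (x - y) / 10" .
  show "?b x *\<^sub>R axis j 1 = (0::real^2)" if "x \<notin> square"
    using ball[of x] that by (cases "norm (x - t) \<le> 30 * r") auto
  show "x + ?b x *\<^sub>R axis j 1 \<in> square" if "x \<in> square"
  proof (cases "norm (x - t) \<le> 30 * r")
    case True
    have "norm (x + ?b x *\<^sub>R axis j 1 - t) = norm ((x - t) + ?b x *\<^sub>R axis j 1)"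
      by (simp add: algebra_simps)
    also have "\<dots> \<le> norm (x - t) + norm (?b x *\<^sub>R (axis j 1 :: real^2))" by (rule norm_triangle_ineq)
    also have "\<dots> = norm (x - t) + ?b x" by (simp add: norm_axis_1)
    \<comment> \<open>At distance d from the center the image has distance at most
      \<open>d + 3 * r - d / 10\<close>, and \<open>9/10 * (30 * r) + 3 * r = 30 * r\<close>: the
      ball is mapped into itself.\<close>
    also have "\<dots> \<le> 30 * r" using True by (auto simp: max_def)
    finally show ?thesis by (rule ball)
  qed (use that in auto)
qed

text \<open>The exact constant \<open>2 powr (1/4)\<close> is what the bumps must respect.
  Everything about estimation works with the rounder constant 2 in both directions.\<close>

lemma bilipschitz_mapsD:
  assumes "f \<in> bilipschitz_maps"
  shows "bij_betw f square square"
    and "\<And>x y. x \<in> square \<Longrightarrow> y \<in> square \<Longrightarrow> norm (f x - f y) \<le> 2 * norm (x - y)"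
    and "\<And>x y. x \<in> square \<Longrightarrow> y \<in> square \<Longrightarrow> norm (x - y) \<le> 2 * norm (f x - f y)"
    and "continuous_on square f"
proof -
  let ?L = "2 powr (1/4) :: real"
  from assms show bij: "bij_betw f square square" and lip: "continuous_on square f"
    by (auto simp: FL_def intro: lipschitz_on_continuous_on)
  fix x y assume xy: "x \<in> square" "y \<in> square"
  have "dist (f x) (f y) \<le> ?L * dist x y"
    using assms xy by (auto simp: FL_def elim!: lipschitz_onD)
  also have "\<dots> \<le> 2 * dist x y" by (intro mult_right_mono quarter_root_two_bounds) auto
  finally show "norm (f x - f y) \<le> 2 * norm (x - y)" by (simp add: dist_norm)
  have fxy: "f x \<in> square" "f y \<in> square" using bij xy by (auto dest: bij_betwE)
  have i: "the_inv_into square f (f x) = x" "the_inv_into square f (f y) = y"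
    using bij xy by (auto intro!: the_inv_into_f_f simp: bij_betw_def)
  have "?L-lipschitz_on square (the_inv_into square f)" using assms by (auto simp: FL_def)
  from lipschitz_onD[OF this fxy] have "dist x y \<le> ?L * dist (f x) (f y)" unfolding i .
  also have "\<dots> \<le> 2 * dist (f x) (f y)" by (intro mult_right_mono quarter_root_two_bounds) auto
  finally show "norm (x - y) \<le> 2 * norm (f x - f y)" by (simp add: dist_norm)
qed

section \<open>Gaussian noise\<close>

text \<open>The density of the centered normal law with covariance \<open>\<sigma>\<^sup>2\<close>
  times the identity, in rotation-invariant form, so that likelihood ratios can be handled by
  completing squares of norms.\<close>

definition gauss :: "real \<Rightarrow> real^2 \<Rightarrow> real" where
  "gauss \<sigma> e = exp (- (norm e)\<^sup>2 / (2 * \<sigma>\<^sup>2)) / (2 * pi * \<sigma>\<^sup>2)"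

lemma gauss_eq_prod: "(\<Prod>j\<in>UNIV. normal_density 0 \<sigma> (e $ j)) = gauss \<sigma> e"
proof -
  have "(norm e)\<^sup>2 = (e $ 1)\<^sup>2 + (e $ 2)\<^sup>2"
    by (simp add: norm_vec_def L2_set_def UNIV_2)
  moreover have "sqrt (2 * pi * \<sigma>\<^sup>2) * sqrt (2 * pi * \<sigma>\<^sup>2) = 2 * pi * \<sigma>\<^sup>2"
    by simp
  ultimately show ?thesis
    by (simp add: gauss_def normal_density_def UNIV_2 exp_add[symmetric] add_divide_distrib diff_divide_distrib field_simps)
qed

lemma gauss_measurable [measurable]: "gauss \<sigma> \<in> borel_measurable borel"
  unfolding gauss_def by measurable

lemma gauss_nonneg [simp]: "0 \<le> gauss \<sigma> e"
  by (simp add: gauss_def)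

lemma noise_eq: "noise \<sigma> = density lborel (\<lambda>e. ennreal (gauss \<sigma> e))"
  by (simp add: noise_def gauss_eq_prod)

lemma sets_noise [measurable_cong, simp]: "sets (noise \<sigma>) = sets borel"
  by (simp add: noise_def)

lemma space_noise [simp]: "space (noise \<sigma>) = UNIV"
  by (simp add: noise_def)

lemma nn_integral_noise_prod:
  assumes [measurable]: "\<And>j. g j \<in> borel_measurable borel"
  shows "(\<integral>\<^sup>+ e. (\<Prod>j\<in>UNIV. g j (e $ j)) \<partial>noise \<sigma>)
       = (\<Prod>j\<in>UNIV. \<integral>\<^sup>+ x. ennreal (normal_density 0 \<sigma> x) * g j x \<partial>lborel)"
proof -
  \<comment> \<open>The product rule for \<open>lborel\<close> is indexed by basis vectors;
    \<open>SOME\<close> recovers the coordinate from its basis vector.\<close>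
  let ?h = "\<lambda>b x. ennreal (normal_density 0 \<sigma> x) * g (SOME j. b = axis j 1) x"
  have inj: "inj (\<lambda>j. axis j (1::real) :: real^2)"
    by (auto simp: inj_on_def axis_eq_axis)
  have B: "(Basis :: (real^2) set) = range (\<lambda>j. axis j 1)"
    by (auto simp: Basis_vec_def)
  have [simp]: "(SOME k. axis j (1::real) = (axis k 1 :: real^2)) = j" for j
    by (rule some_equality) (auto simp: axis_eq_axis)
  have "(\<integral>\<^sup>+ e. (\<Prod>j\<in>UNIV. g j (e $ j)) \<partial>noise \<sigma>)
      = (\<integral>\<^sup>+ e. (\<Prod>j\<in>UNIV. ennreal (normal_density 0 \<sigma> (e $ j)) * g j (e $ j)) \<partial>lborel)"
    unfolding noise_def
    by (subst nn_integral_density) (auto simp: prod.distrib prod_ennreal intro!: nn_integral_cong)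
  also have "\<dots> = (\<integral>\<^sup>+ e. (\<Prod>b\<in>Basis. ?h b (e \<bullet> b)) \<partial>(lborel :: (real^2) measure))"
    unfolding B by (subst prod.reindex[OF inj]) (simp add: cart_eq_inner_axis)
  also have "\<dots> = (\<Prod>b\<in>(Basis :: (real^2) set). \<integral>\<^sup>+ x. ?h b x \<partial>lborel)"
    by (rule nn_integral_lborel_prod) auto
  also have "\<dots> = (\<Prod>j\<in>UNIV. \<integral>\<^sup>+ x. ennreal (normal_density 0 \<sigma> x) * g j x \<partial>lborel)"
    unfolding B by (subst prod.reindex[OF inj]) simp
  finally show ?thesis .
qed

lemma nn_integral_normal_density:
  assumes "\<sigma> > 0" shows "(\<integral>\<^sup>+ x. ennreal (normal_density \<mu> \<sigma> x) \<partial>lborel) = 1"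
proof -
  interpret prob_space "density lborel (normal_density \<mu> \<sigma>)"
    using assms by (rule prob_space_normal_density)
  show ?thesis using emeasure_space_1 by (simp add: emeasure_density)
qed

lemma distr_noise_component:
  assumes "\<sigma> > 0"
  shows "distr (noise \<sigma>) borel (\<lambda>e. e $ j) = density lborel (normal_density 0 \<sigma>)"
proof (rule measure_eqI)
  fix A assume "A \<in> sets (distr (noise \<sigma>) borel (\<lambda>e. e $ j))"
  then have [measurable]: "A \<in> sets borel" by simp
  \<comment> \<open>With the constant 1 in the other coordinate, that factor integrates to 1 and
    only the one-dimensional normal law remains.\<close>
  let ?g = "\<lambda>k x. if k = j then indicator A x else (1::ennreal)"
  have "emeasure (distr (noise \<sigma>) borel (\<lambda>e. e $ j)) A
      = (\<integral>\<^sup>+ e. indicator A (e $ j) \<partial>noise \<sigma>)"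
    using nn_integral_distr[of "\<lambda>e. e $ j" "noise \<sigma>" borel "indicator A"] by simp
  also have "\<dots> = (\<integral>\<^sup>+ e. (\<Prod>k\<in>UNIV. ?g k (e $ k)) \<partial>noise \<sigma>)"
    by (simp add: prod.delta)
  also have "\<dots> = (\<Prod>k\<in>UNIV. \<integral>\<^sup>+ x. ennreal (normal_density 0 \<sigma> x) * ?g k x \<partial>lborel)"
    by (rule nn_integral_noise_prod) auto
  also have "\<dots> = (\<Prod>k\<in>UNIV. if k = j then emeasure (density lborel (normal_density 0 \<sigma>)) A else 1)"
    using assms by (intro prod.cong) (auto simp: emeasure_density nn_integral_normal_density)
  also have "\<dots> = emeasure (density lborel (normal_density 0 \<sigma>)) A"
    by (simp add: prod.delta)
  finally show "emeasure (distr (noise \<sigma>) borel (\<lambda>e. e $ j)) A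
      = emeasure (density lborel (normal_density 0 \<sigma>)) A" .
qed simp

lemma prob_space_noise:
  assumes "\<sigma> > 0" shows "prob_space (noise \<sigma>)"
proof -
  interpret D: prob_space "density lborel (normal_density 0 \<sigma>)"
    using assms by (rule prob_space_normal_density)
  have "emeasure (noise \<sigma>) (space (noise \<sigma>))
      = emeasure (distr (noise \<sigma>) borel (\<lambda>e. e $ (1::2))) UNIV"
    by (simp add: emeasure_distr)
  also have "\<dots> = 1" using D.emeasure_space_1 by (simp add: distr_noise_component assms)
  finally show ?thesis by (rule prob_spaceI)
qed

lemma noise_moments:
  assumes "\<sigma> > 0"
  shows "integrable (noise \<sigma>) (\<lambda>e. e $ j)" "(\<integral>e. e $ j \<partial>noise \<sigma>) = 0"
    and "integrable (noise \<sigma>) (\<lambda>e. (e $ j)\<^sup>2)" "(\<integral>e. (e $ j)\<^sup>2 \<partial>noise \<sigma>) = \<sigma>\<^sup>2"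
proof -
  let ?D = "density lborel (normal_density 0 \<sigma>)"
  have tr: "integrable (noise \<sigma>) (\<lambda>e. g (e $ j)) \<longleftrightarrow> integrable ?D g"
     "(\<integral>e. g (e $ j) \<partial>noise \<sigma>) = integral\<^sup>L ?D g"
    if [measurable]: "g \<in> borel_measurable borel" for g :: "real \<Rightarrow> real"
    unfolding distr_noise_component[OF assms, of j, symmetric]
    by (auto simp: integrable_distr_eq integral_distr)
  have i1: "integrable ?D (\<lambda>x. x)" "integral\<^sup>L ?D (\<lambda>x. x) = 0"
    using integrable_normal_moment_nz_1[OF assms, of 0] integral_normal_moment_nz_1[OF assms, of 0]
    by (auto simp: integrable_density integral_density)
  have i2: "integrable ?D (\<lambda>x. x\<^sup>2)" "integral\<^sup>L ?D (\<lambda>x. x\<^sup>2) = \<sigma>\<^sup>2"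
    using integrable_normal_moment[OF assms, of 0 2] integral_normal_moment_even[OF assms, of 0 1]
    by (auto simp: integrable_density integral_density eval_nat_numeral)
  show "integrable (noise \<sigma>) (\<lambda>e. e $ j)"
    by (rule tr(1)[THEN iffD2, OF _ i1(1)]) measurable
  show "(\<integral>e. e $ j \<partial>noise \<sigma>) = 0"
    by (rule trans[OF tr(2) i1(2)]) measurable
  show "integrable (noise \<sigma>) (\<lambda>e. (e $ j)\<^sup>2)"
    by (rule tr(1)[THEN iffD2, OF _ i2(1)]) measurable
  show "(\<integral>e. (e $ j)\<^sup>2 \<partial>noise \<sigma>) = \<sigma>\<^sup>2"
    by (rule trans[OF tr(2) i2(2)]) measurable
qed

lemma nn_integral_gauss_shift:
  assumes "\<sigma> > 0" shows "(\<integral>\<^sup>+ y. ennreal (gauss \<sigma> (y - a)) \<partial>lborel) = 1"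
proof -
  interpret prob_space "noise \<sigma>" using assms by (rule prob_space_noise)
  have "(\<integral>\<^sup>+ y. ennreal (gauss \<sigma> (y - a)) \<partial>lborel)
     = (\<integral>\<^sup>+ y. ennreal (gauss \<sigma> (y - a)) \<partial>distr lborel borel ((+) a))"
    by (simp add: lborel_distr_plus)
  also have "\<dots> = (\<integral>\<^sup>+ y. ennreal (gauss \<sigma> y) \<partial>lborel)"
    by (subst nn_integral_distr) auto
  also have "\<dots> = 1"
    using emeasure_space_1 unfolding noise_eq by (simp add: emeasure_density)
  finally show ?thesis .
qed

section \<open>Laws and moments\<close>

text \<open>The inequality \<open>w \<le> w\<^sup>2 / 6 + 3/2\<close> is
  \<open>(w - 3)\<^sup>2 \<ge> 0\<close>. It replaces Cauchy-Schwarz when a likelihood ratio is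
  integrated over an event of mass at most 1/4 that has mass at least 3/4 under the other law. The
  tangent point 3 is the ratio of these masses, so nothing is lost: both routes give the second
  moment bound \<open>(3/4)\<^sup>2 / (1/4) = 9/4\<close>.\<close>

lemma weighted_am_gm:
  fixes x :: ennreal
  shows "x * indicator E D \<le> ennreal (1/6) * x\<^sup>2 + ennreal (3/2) * indicator E D"
proof (cases "D \<in> E")
  case True
  have "x \<le> ennreal (1/6) * x\<^sup>2 + ennreal (3/2)"
  proof (cases x)
    case (real w)
    have "0 \<le> (w - 3)\<^sup>2" by simp
    then have "w \<le> 1/6 * w\<^sup>2 + 3/2" by (simp add: power2_eq_square algebra_simps)
    then have "ennreal w \<le> ennreal (1/6 * w\<^sup>2 + 3/2)" by (rule ennreal_leI)
    also have "\<dots> = ennreal (1/6 * w\<^sup>2) + ennreal (3/2)" by (rule ennreal_plus) auto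
    also have "ennreal (1/6 * w\<^sup>2) = ennreal (1/6) * ennreal (w\<^sup>2)" by (rule ennreal_mult) auto
    also have "ennreal (w\<^sup>2) = (ennreal w)\<^sup>2" using real by (intro ennreal_power[symmetric])
    finally show ?thesis using real by simp
  qed (simp add: ennreal_mult_top)
  then show ?thesis using True by simp
qed simp

lemma chi_square_bound:
  assumes "ennreal (3/4) \<le> ennreal (1/6) * x + ennreal (3/8)"
  shows "ennreal (9/4) \<le> x"
proof (cases x)
  case (real c)
  have "ennreal (1/6) * x + ennreal (3/8) = ennreal (1/6 * c) + ennreal (3/8)"
    unfolding real(2) using real(1) by (subst ennreal_mult) auto
  also have "\<dots> = ennreal (1/6 * c + 3/8)"
    using real(1) by (intro ennreal_plus[symmetric]) auto
  finally have "ennreal (3/4) \<le> ennreal (1/6 * c + 3/8)" using assms by simp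
  then have "3/4 \<le> 1/6 * c + 3/8" using real by (subst (asm) ennreal_le_iff) auto
  then show ?thesis unfolding real(2) by (intro ennreal_leI) simp
qed simp

text \<open>A product measure is determined by its values on rectangles, and on a rectangle the
  integral of the product density splits into one factor per coordinate. This carries a likelihood
  ratio from one observation to the sample.\<close>

lemma PiM_density:
  assumes I: "finite I" and [measurable]: "w \<in> borel_measurable M"
    and M: "sigma_finite_measure M" and D: "sigma_finite_measure (density M w)"
  shows "PiM I (\<lambda>_. density M w) = density (PiM I (\<lambda>_. M)) (\<lambda>x. \<Prod>i\<in>I. w (x i))"
proof (rule sym, rule product_sigma_finite.PiM_eqI[OF _ I])
  interpret M: product_sigma_finite "\<lambda>_. M" using M by (simp add: product_sigma_finite_def)
  show "product_sigma_finite (\<lambda>_. density M w)" using D by (simp add: product_sigma_finite_def)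
  show "sets (density (PiM I (\<lambda>_. M)) (\<lambda>x. \<Prod>i\<in>I. w (x i))) = sets (PiM I (\<lambda>_. density M w))"
    by (simp cong: sets_PiM_cong)
  fix A assume A: "\<And>i. i \<in> I \<Longrightarrow> A i \<in> sets (density M w)"
  have [measurable]: "Pi\<^sub>E I A \<in> sets (PiM I (\<lambda>_. M))"
    using A I by (intro sets_PiM_I_finite) auto
  have "emeasure (density (PiM I (\<lambda>_. M)) (\<lambda>x. \<Prod>i\<in>I. w (x i))) (Pi\<^sub>E I A)
      = (\<integral>\<^sup>+ x. (\<Prod>i\<in>I. w (x i)) * indicator (Pi\<^sub>E I A) x \<partial>PiM I (\<lambda>_. M))"
    by (rule emeasure_density) auto
  also have "\<dots> = (\<integral>\<^sup>+ x. (\<Prod>i\<in>I. w (x i) * indicator (A i) (x i)) \<partial>PiM I (\<lambda>_. M))"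
  proof (intro nn_integral_cong)
    fix x assume x: "x \<in> space (PiM I (\<lambda>_. M))"
    have "indicator (Pi\<^sub>E I A) x = (\<Prod>i\<in>I. indicator (A i) (x i) :: ennreal)"
    proof (cases "x \<in> Pi\<^sub>E I A")
      case False
      then obtain i where "i \<in> I" "x i \<notin> A i" using x by (auto simp: space_PiM PiE_def)
      then have "(\<Prod>i\<in>I. indicator (A i) (x i) :: ennreal) = 0"
        using I by (intro prod_zero bexI[of _ i]) auto
      then show ?thesis using False by simp
    qed (auto simp: PiE_def Pi_def intro!: prod.neutral[symmetric])
    then show "(\<Prod>i\<in>I. w (x i)) * indicator (Pi\<^sub>E I A) x = (\<Prod>i\<in>I. w (x i) * indicator (A i) (x i))"
      by (simp add: prod.distrib)
  qed
  also have "\<dots> = (\<Prod>i\<in>I. \<integral>\<^sup>+ x. w x * indicator (A i) x \<partial>M)"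
    using A by (intro M.product_nn_integral_prod I) auto
  also have "\<dots> = (\<Prod>i\<in>I. emeasure (density M w) (A i))"
    using A by (intro prod.cong) (auto simp: emeasure_density)
  finally show "emeasure (density (PiM I (\<lambda>_. M)) (\<lambda>x. \<Prod>i\<in>I. w (x i))) (Pi\<^sub>E I A)
      = (\<Prod>i\<in>I. emeasure (density M w) (A i))" .
qed

lemma sets_P_X [measurable_cong, simp]: "sets (P_X p) = sets (restrict_space borel square)"
  unfolding P_X_def by (simp cong: sets_restrict_space_cong)

lemma square_borel [measurable, simp]: "square \<in> sets borel"
  by (simp add: square_def)

lemma space_P_X [simp]: "space (P_X p) = square"
  by (simp add: P_X_def space_restrict_space)

abbreviation measurable_map :: "(real^2 \<Rightarrow> real^2) \<Rightarrow> bool" where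
  "measurable_map f \<equiv> f \<in> restrict_space borel square \<rightarrow>\<^sub>M borel"

lemma sets_obs_law [measurable_cong, simp]: "sets (obs_law p \<sigma> f) = sets obs_space"
  by (simp add: obs_law_def)

lemma sets_sample_law [measurable_cong, simp]: "sets (sample_law p \<sigma> n f) = sets (sample_space n)"
  unfolding sample_law_def by (rule sets_PiM_cong[OF refl sets_obs_law])

lemma borel_box_around [measurable]: "box_around t h \<in> sets borel"
  unfolding box_around_def by measurable

lemma Linf_normD:
  assumes "Linf_norm f \<le> ennreal r" "0 \<le> r" "x \<in> square"
  shows "\<bar>f x $ j\<bar> \<le> r"
proof -
  have "ennreal \<bar>f x $ j\<bar> \<le> (SUP x\<in>square. ennreal \<bar>f x $ j\<bar>)"
    using assms(3) by (rule SUP_upper)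
  also have "\<dots> \<le> Linf_norm f" unfolding Linf_norm_def by (intro Max_ge) auto
  also have "\<dots> \<le> ennreal r" by fact
  finally show ?thesis using assms(2) by simp
qed

lemma bilipschitz_maps_measurable:
  assumes "f \<in> bilipschitz_maps" shows "measurable_map f"
  using bilipschitz_mapsD(4)[OF assms] by (rule borel_measurable_continuous_on_restrict)

text \<open>Bias-variance decomposition. After centering, the n off-diagonal-free terms of the
  squared sum survive: \<open>W (D i) * W (D k)\<close> integrates to 0 unless
  \<open>i = k\<close>.\<close>

lemma iid_mean_mse:
  fixes Z :: "'a \<Rightarrow> real" and n :: nat
  assumes M: "prob_space M" and [measurable]: "Z \<in> borel_measurable M"
    and Z2: "integrable M (\<lambda>z. (Z z)\<^sup>2)" and n: "n > 0"
  defines "\<mu> \<equiv> integral\<^sup>L M Z"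
  shows "integrable (PiM {..<n} (\<lambda>_. M)) (\<lambda>D. ((\<Sum>i<n. Z (D i)) / n - a)\<^sup>2)"
    and "(\<integral>D. ((\<Sum>i<n. Z (D i)) / n - a)\<^sup>2 \<partial>PiM {..<n} (\<lambda>_. M))
      = (\<mu> - a)\<^sup>2 + ((\<integral>z. (Z z)\<^sup>2 \<partial>M) - \<mu>\<^sup>2) / n"
proof -
  interpret M: prob_space M by fact
  interpret P: product_sigma_finite "\<lambda>_. M"
    unfolding product_sigma_finite_def by (rule allI) (rule M.sigma_finite_measure_axioms)
  interpret PP: prob_space "PiM {..<n} (\<lambda>_. M)" by (rule prob_space_PiM) (rule M)
  let ?P = "PiM {..<n} (\<lambda>_. M)"
  have Z: "integrable M Z" by (rule M.square_integrable_imp_integrable[OF assms(2) Z2])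
  define W where "W z = Z z - \<mu>" for z
  have [measurable]: "W \<in> borel_measurable M" unfolding W_def by measurable
  have W: "integrable M W" "integral\<^sup>L M W = 0"
    unfolding W_def by (simp_all add: Z M.prob_space \<mu>_def)
  have W2_eq: "(W z)\<^sup>2 = (Z z)\<^sup>2 - 2 * \<mu> * Z z + \<mu>\<^sup>2" for z
    by (simp add: W_def power2_diff)
  have W2: "integrable M (\<lambda>z. W z * W z)" "(\<integral>z. W z * W z \<partial>M) = (\<integral>z. (Z z)\<^sup>2 \<partial>M) - \<mu>\<^sup>2"
  proof -
    have i: "integrable M (\<lambda>z. 2 * \<mu> * Z z)" using Z by (rule integrable_mult_right)
    have eq: "W z * W z = (Z z)\<^sup>2 - 2 * \<mu> * Z z + \<mu>\<^sup>2" for z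
      using W2_eq[of z] by (simp only: power2_eq_square)
    show "integrable M (\<lambda>z. W z * W z)"
      unfolding eq by (intro Bochner_Integration.integrable_add Bochner_Integration.integrable_diff Z2 i M.integrable_const)
    have "(\<integral>z. W z * W z \<partial>M) = (\<integral>z. (Z z)\<^sup>2 \<partial>M) - 2 * \<mu> * integral\<^sup>L M Z + \<mu>\<^sup>2"
      unfolding eq using Z2 i by (simp add: M.prob_space)
    then show "(\<integral>z. W z * W z \<partial>M) = (\<integral>z. (Z z)\<^sup>2 \<partial>M) - \<mu>\<^sup>2"
      unfolding \<mu>_def by (simp add: power2_eq_square)
  qed
  have pair: "integrable ?P (\<lambda>D. W (D i) * W (D k))"
    "(\<integral>D. W (D i) * W (D k) \<partial>?P) = (if i = k then (\<integral>z. (Z z)\<^sup>2 \<partial>M) - \<mu>\<^sup>2 else 0)"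
    if ik: "i < n" "k < n" for i k
  proof -
    \<comment> \<open>Writing \<open>W (D i) * W (D k)\<close> as a product over all coordinates
      lets Fubini treat both cases at once: for \<open>i = k\<close> the two factors meet in one
      coordinate and form a square, otherwise each stands alone with integral 0.\<close>
    define F where "F l z = (if l = i then W z else 1) * (if l = k then W z else 1)" for l z
    have F: "integrable M (F l)" for l
      unfolding F_def using W W2 by (cases "l = i"; cases "l = k") auto
    have eq: "(\<Prod>l<n. F l (D l)) = W (D i) * W (D k)" for D
      unfolding F_def prod.distrib using ik by (simp add: prod.delta)
    have int: "(\<Prod>l<n. integral\<^sup>L M (F l)) = (if i = k then (\<integral>z. (Z z)\<^sup>2 \<partial>M) - \<mu>\<^sup>2 else 0)"
    proof (cases "i = k")
      case True
      have "integral\<^sup>L M (F l) = (if l = i then (\<integral>z. (Z z)\<^sup>2 \<partial>M) - \<mu>\<^sup>2 else 1)" for l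
        unfolding F_def using True W2 by (auto simp: M.prob_space)
      then show ?thesis using ik True by (simp add: prod.delta)
    next
      case False
      then have "integral\<^sup>L M (F i) = 0" unfolding F_def using W by simp
      then show ?thesis using False ik by (auto intro!: prod_zero bexI[of _ i])
    qed
    show "integrable ?P (\<lambda>D. W (D i) * W (D k))"
      using P.product_integrable_prod[of "{..<n}" F] F unfolding eq by simp
    show "(\<integral>D. W (D i) * W (D k) \<partial>?P) = (if i = k then (\<integral>z. (Z z)\<^sup>2 \<partial>M) - \<mu>\<^sup>2 else 0)"
      using P.product_integral_prod[of "{..<n}" F] F unfolding eq int by simp
  qed
  have single: "integrable ?P (\<lambda>D. W (D i))" "(\<integral>D. W (D i) \<partial>?P) = 0" if i: "i < n" for i
  proof -
    define F where "F l z = (if l = i then W z else 1)" for l z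
    have F: "integrable M (F l)" for l unfolding F_def using W by (cases "l = i") auto
    have eq: "(\<Prod>l<n. F l (D l)) = W (D i)" for D
      unfolding F_def using i by (simp add: prod.delta)
    have "integral\<^sup>L M (F i) = 0" unfolding F_def using W by simp
    then have int: "(\<Prod>l<n. integral\<^sup>L M (F l)) = 0"
      using i by (auto intro!: prod_zero bexI[of _ i])
    show "integrable ?P (\<lambda>D. W (D i))"
      using P.product_integrable_prod[of "{..<n}" F] F unfolding eq by simp
    show "(\<integral>D. W (D i) \<partial>?P) = 0"
      using P.product_integral_prod[of "{..<n}" F] F unfolding eq int by simp
  qed
  have expand: "((\<Sum>i<n. Z (D i)) / n - a)\<^sup>2
      = (\<Sum>i<n. \<Sum>k<n. W (D i) * W (D k)) / (real n)\<^sup>2 + 2 * (\<mu> - a) / n * (\<Sum>i<n. W (D i)) + (\<mu> - a)\<^sup>2" for D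
  proof -
    have "(\<Sum>i<n. Z (D i)) = (\<Sum>i<n. W (D i)) + n * \<mu>" by (simp add: W_def sum_subtractf)
    then have "(\<Sum>i<n. Z (D i)) / n - a = (\<Sum>i<n. W (D i)) / n + (\<mu> - a)"
      using n by (simp add: add_divide_distrib)
    also have "\<dots>\<^sup>2 = (\<Sum>i<n. W (D i))\<^sup>2 / (real n)\<^sup>2 + 2 * (\<mu> - a) / n * (\<Sum>i<n. W (D i)) + (\<mu> - a)\<^sup>2"
      unfolding power2_sum power_divide by simp
    finally show ?thesis by (simp add: power2_eq_square sum_product)
  qed
  define V where "V = (\<integral>z. (Z z)\<^sup>2 \<partial>M) - \<mu>\<^sup>2"
  note pair' = pair[folded V_def]
  have row: "integrable ?P (\<lambda>D. \<Sum>k<n. W (D i) * W (D k))"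
    "(\<integral>D. (\<Sum>k<n. W (D i) * W (D k)) \<partial>?P) = V" if "i < n" for i
  proof -
    show "integrable ?P (\<lambda>D. \<Sum>k<n. W (D i) * W (D k))"
      using that by (intro Bochner_Integration.integrable_sum pair') auto
    have "(\<integral>D. (\<Sum>k<n. W (D i) * W (D k)) \<partial>?P) = (\<Sum>k<n. \<integral>D. W (D i) * W (D k) \<partial>?P)"
      using that by (intro Bochner_Integration.integral_sum pair') auto
    also have "\<dots> = (\<Sum>k<n. if i = k then V else 0)"
      using that by (intro sum.cong pair') auto
    finally show "(\<integral>D. (\<Sum>k<n. W (D i) * W (D k)) \<partial>?P) = V" using that by (simp add: sum.delta)
  qed
  have S2: "integrable ?P (\<lambda>D. (\<Sum>i<n. \<Sum>k<n. W (D i) * W (D k)) / (real n)\<^sup>2)"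
    "(\<integral>D. (\<Sum>i<n. \<Sum>k<n. W (D i) * W (D k)) / (real n)\<^sup>2 \<partial>?P) = V / n"
  proof -
    show "integrable ?P (\<lambda>D. (\<Sum>i<n. \<Sum>k<n. W (D i) * W (D k)) / (real n)\<^sup>2)"
      by (intro integrable_divide_zero Bochner_Integration.integrable_sum row) auto
    have "(\<integral>D. (\<Sum>i<n. \<Sum>k<n. W (D i) * W (D k)) \<partial>?P) = (\<Sum>i<n. \<integral>D. (\<Sum>k<n. W (D i) * W (D k)) \<partial>?P)"
      by (intro Bochner_Integration.integral_sum row) auto
    also have "\<dots> = n * V" using row by simp
    finally show "(\<integral>D. (\<Sum>i<n. \<Sum>k<n. W (D i) * W (D k)) / (real n)\<^sup>2 \<partial>?P) = V / n"
      using n by (simp add: power2_eq_square)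
  qed
  have S1: "integrable ?P (\<lambda>D. c * (\<Sum>i<n. W (D i)))" "(\<integral>D. c * (\<Sum>i<n. W (D i)) \<partial>?P) = 0" for c
  proof -
    show "integrable ?P (\<lambda>D. c * (\<Sum>i<n. W (D i)))"
      by (intro integrable_mult_right Bochner_Integration.integrable_sum single) auto
    have "(\<integral>D. (\<Sum>i<n. W (D i)) \<partial>?P) = (\<Sum>i<n. \<integral>D. W (D i) \<partial>?P)"
      by (intro Bochner_Integration.integral_sum single) auto
    also have "\<dots> = 0" by (intro sum.neutral ballI single) auto
    finally show "(\<integral>D. c * (\<Sum>i<n. W (D i)) \<partial>?P) = 0" by simp
  qed
  show "integrable ?P (\<lambda>D. ((\<Sum>i<n. Z (D i)) / n - a)\<^sup>2)"
    unfolding expand by (intro Bochner_Integration.integrable_add S1 S2 PP.integrable_const)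
  show "(\<integral>D. ((\<Sum>i<n. Z (D i)) / n - a)\<^sup>2 \<partial>?P)
      = (\<mu> - a)\<^sup>2 + ((\<integral>z. (Z z)\<^sup>2 \<partial>M) - \<mu>\<^sup>2) / n"
    unfolding expand V_def[symmetric]
    by (simp only: Bochner_Integration.integral_add Bochner_Integration.integrable_add S1 S2
        PP.integrable_const lebesgue_integral_const PP.prob_space) simp
qed

section \<open>Grid cells and the loss of the inverse\<close>

definition grid :: "nat \<Rightarrow> (2 \<Rightarrow> nat) set" where
  "grid m = {a. \<forall>j. a j < m}"

text \<open>The square has side 2, so a partition into \<open>m\<^sup>2\<close> cells has half-width
  \<open>1 / m\<close>. Adjacent closed cells share edges, which is harmless: the estimates below
  use a cover and treat each cell on its own.\<close>

definition center :: "nat \<Rightarrow> (2 \<Rightarrow> nat) \<Rightarrow> real^2" where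
  "center m a = (\<chi> j. (2 * real (a j) + 1) / m - 1)"

definition cell :: "nat \<Rightarrow> (2 \<Rightarrow> nat) \<Rightarrow> (real^2) set" where
  "cell m a = box_around (center m a) (1 / m)"

lemma grid_eq: "grid m = (UNIV \<rightarrow>\<^sub>E {..<m})"
  by (auto simp: grid_def PiE_def Pi_def)

lemma finite_grid [simp]: "finite (grid m)"
  unfolding grid_eq by (intro finite_PiE) auto

lemma card_grid: "card (grid m) = m\<^sup>2"
  unfolding grid_eq by (subst card_PiE) auto

lemma cell_subset_square:
  assumes "a \<in> grid m" shows "cell m a \<subseteq> square"
proof
  fix x assume x: "x \<in> cell m a"
  show "x \<in> square" unfolding mem_square
  proof
    fix j
    have "a j < m" using assms by (simp add: grid_def)
    then have a: "real (a j) + 1 \<le> m" by linarith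
    then have m: "real m > 0" by linarith
    have "\<bar>x $ j - ((2 * real (a j) + 1) / m - 1)\<bar> \<le> 1 / m"
      using x by (simp add: cell_def box_around_def center_def)
    then have l: "(2 * real (a j) + 1) / m - 1 / m - 1 \<le> x $ j" and u: "x $ j \<le> (2 * real (a j) + 1) / m + 1 / m - 1"
      by linarith+
    have "0 \<le> (2 * real (a j) + 1) / m - 1 / m" by (simp add: diff_divide_distrib[symmetric])
    moreover have "(2 * real (a j) + 1) / m + 1 / m \<le> 2"
      using a m by (simp add: add_divide_distrib[symmetric] divide_le_eq)
    ultimately show "- 1 \<le> x $ j \<and> x $ j \<le> 1" using l u by linarith
  qed
qed

lemma center_in_cell: "center m a \<in> cell m a"
  by (simp add: cell_def box_around_def)

lemma center_in_square: "a \<in> grid m \<Longrightarrow> center m a \<in> square"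
  using cell_subset_square center_in_cell by blast

lemma cells_cover:
  assumes m: "m > 0" and x: "x \<in> square"
  obtains a where "a \<in> grid m" "x \<in> cell m a"
proof -
  \<comment> \<open>The minimum with \<open>m - 1\<close> concerns the edge
    \<open>x $ j = 1\<close>, where the floor would be m; that edge belongs to the last closed
    cell.\<close>
  define a where "a j = min (m - 1) (nat \<lfloor>(x $ j + 1) * m / 2\<rfloor>)" for j
  have "a \<in> grid m" using m by (auto simp: grid_def a_def)
  moreover have "\<bar>x $ j - ((2 * real (a j) + 1) / m - 1)\<bar> \<le> 1 / m" for j
  proof -
    define u where "u = (x $ j + 1) * m / 2"
    have xj: "- 1 \<le> x $ j" "x $ j \<le> 1" using x by (auto simp: mem_square)
    have u: "0 \<le> u" "u \<le> m" using xj m by (auto simp: u_def intro: mult_right_mono[of _ 2, simplified])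
    have "\<bar>2 * u - (2 * real (a j) + 1)\<bar> \<le> 1"
    proof (cases "nat \<lfloor>u\<rfloor> \<le> m - 1")
      case True
      then have "real (a j) = of_int \<lfloor>u\<rfloor>" using u by (simp add: a_def u_def[symmetric] min_def)
      then show ?thesis by linarith
    next
      case False
      then have "u \<ge> m" by linarith
      then have "u = m" using u by simp
      moreover have "real (a j) = real m - 1" using False m by (simp add: a_def u_def[symmetric] min_def of_nat_diff)
      ultimately show ?thesis by simp
    qed
    then have "\<bar>2 * u - (2 * real (a j) + 1)\<bar> / m \<le> 1 / m" by (intro divide_right_mono) auto
    also have "\<bar>2 * u - (2 * real (a j) + 1)\<bar> / m = \<bar>(2 * u - (2 * real (a j) + 1)) / m\<bar>" by simp
    also have "(2 * u - (2 * real (a j) + 1)) / m = x $ j - ((2 * real (a j) + 1) / m - 1)"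
      using m by (simp add: u_def field_simps)
    finally show ?thesis .
  qed
  ultimately show ?thesis using that by (auto simp: cell_def box_around_def center_def)
qed

lemma norm_le_box:
  fixes x :: "real^2"
  assumes "\<And>j. \<bar>x $ j\<bar> \<le> h" shows "norm x \<le> 2 * h"
proof -
  have "norm x \<le> (\<Sum>j\<in>UNIV. \<bar>x $ j\<bar>)" by (rule norm_le_l1_cart)
  also have "\<dots> \<le> 2 * h" using assms[of 1] assms[of 2] by (simp add: UNIV_2)
  finally show ?thesis .
qed

lemma norm_sq_eq: "(norm (x :: real^2))\<^sup>2 = (\<Sum>j\<in>UNIV. (x $ j)\<^sup>2)"
  by (simp add: norm_vec_def L2_set_def sum_nonneg)

lemma cell_diameter: "x \<in> cell m a \<Longrightarrow> norm (x - center m a) \<le> 2 / m"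
  using norm_le_box[of "x - center m a" "1 / m"] by (simp add: cell_def box_around_def)

lemma add_sq_le: "(a + b :: real)\<^sup>2 \<le> 2 * a\<^sup>2 + 2 * b\<^sup>2"
  using zero_le_power2[of "a - b"] by (simp add: power2_sum power2_diff)

lemma norm_add_sq_le: "(norm (x + y :: real^2))\<^sup>2 \<le> 2 * (norm x)\<^sup>2 + 2 * (norm y)\<^sup>2"
proof -
  have "(norm (x + y))\<^sup>2 \<le> (norm x + norm y)\<^sup>2" by (intro power_mono norm_triangle_ineq) auto
  also have "\<dots> \<le> 2 * (norm x)\<^sup>2 + 2 * (norm y)\<^sup>2" by (rule add_sq_le)
  finally show ?thesis .
qed

lemma emeasure_box_around:
  assumes "0 \<le> h" shows "emeasure lborel (box_around t h) = ennreal ((2 * h)\<^sup>2)"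
proof -
  have eq: "box_around t h = cbox (\<chi> j. t $ j - h) (\<chi> j. t $ j + h)"
    unfolding box_around_def cbox_interval mem_box_cart
    by (auto simp: abs_le_iff interval_cbox_cart mem_box_cart diff_le_eq le_diff_eq minus_le_iff algebra_simps)
  have "(\<chi> j. t $ j) \<in> cbox (\<chi> j. t $ j - h) (\<chi> j. t $ j + h :: real^2)"
    using assms by (simp add: mem_box_cart)
  then have "measure lborel (cbox (\<chi> j. t $ j - h) (\<chi> j. t $ j + h :: real^2)) = (\<Prod>j\<in>(UNIV::2 set). 2 * h)"
    by (subst content_cbox_cart) auto
  then show ?thesis
    unfolding eq using emeasure_lborel_cbox_finite
    by (subst emeasure_eq_ennreal_measure) (auto simp: less_top)
qed

lemma emeasure_P_X_le:
  assumes p [measurable]: "p \<in> borel_measurable (restrict_space borel square)"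
    and B: "\<And>x. x \<in> square \<Longrightarrow> p x \<le> B" and A: "A \<in> sets borel"
  shows "emeasure (P_X p) (A \<inter> square) \<le> ennreal B * emeasure lborel A"
proof -
  have AS: "A \<inter> square \<in> sets (restrict_space lborel square)" using A by (auto simp: sets_restrict_space_iff)
  have pm: "(\<lambda>x. ennreal (p x)) \<in> borel_measurable (restrict_space lborel square)"
    using p by (simp cong: measurable_cong_sets sets_restrict_space_cong)
  have "emeasure (P_X p) (A \<inter> square)
      = (\<integral>\<^sup>+ x. ennreal (p x) * indicator (A \<inter> square) x \<partial>restrict_space lborel square)"
    unfolding P_X_def by (rule emeasure_density[OF pm AS])
  also have "\<dots> \<le> (\<integral>\<^sup>+ x. ennreal B * indicator (A \<inter> square) x \<partial>restrict_space lborel square)"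
    using B by (intro nn_integral_mono) (auto simp: space_restrict_space intro!: mult_right_mono ennreal_leI)
  also have "\<dots> = ennreal B * emeasure (restrict_space lborel square) (A \<inter> square)"
    using AS by (rule nn_integral_cmult_indicator)
  also have "\<dots> \<le> ennreal B * emeasure lborel A"
    using A by (subst emeasure_restrict_space) (auto intro!: mult_left_mono emeasure_mono)
  finally show ?thesis .
qed

text \<open>The reason for choosing the estimator among bijections of the square: on the square the
  default value c is never returned.\<close>

lemma quasi_inverse_eq:
  assumes "bij_betw g square square" "x \<in> square"
  shows "quasi_inverse c g (g x) = x"
proof -
  have *: "z = x" if "z \<in> square \<and> g z = g x" for z
    using that assms by (auto simp: bij_betw_def inj_on_def)
  then have "\<exists>!z. z \<in> square \<and> g z = g x" using assms(2) by blast
  then show ?thesis unfolding quasi_inverse_def using * assms(2) by (auto intro!: the_equality)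
qed

text \<open>No change of variables is needed for the inverses: \<open>square\<close> is the union of the images of the
  cells under \<open>g\<close>, and each image lies in a box of comparable size.\<close>

lemma inverse_loss_le:
  assumes p: "p \<in> borel_measurable (restrict_space borel square)"
    and B: "\<And>x. x \<in> square \<Longrightarrow> p x \<le> B" "0 \<le> B"
    and m: "m > 0" and f: "f \<in> bilipschitz_maps" and g: "g \<in> bilipschitz_maps"
  shows "L2_norm_sq (P_X p) (\<lambda>y. quasi_inverse c g y - the_inv_into square f y)
    \<le> ennreal (1024 * B / (real m)\<^sup>2 * ((\<Sum>a\<in>grid m. (norm (g (center m a) - f (center m a)))\<^sup>2) + 64))"
proof -
  define h where "h = 1 / real m"
  have h: "h > 0" using m by (simp add: h_def)
  let ?t = "center m"
  let ?d = "\<lambda>a. norm (g (?t a) - f (?t a))"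
  \<comment> \<open>This is the bound \<open>4 * (d + 8 * h)\<^sup>2 \<le> 8 * d\<^sup>2 + 512 *
    h\<^sup>2\<close>, where d is the error at the cell center and \<open>8 * h\<close> collects the
    variation of f and g over the cell, \<open>4 * h\<close> each.\<close>
  let ?w = "\<lambda>a. 8 * (?d a)\<^sup>2 + 512 * h\<^sup>2"
  let ?A = "\<lambda>a. box_around (g (?t a)) (4 * h) \<inter> square"
  let ?u = "\<lambda>y. quasi_inverse c g y - the_inv_into square f y"
  note fD = bilipschitz_mapsD[OF f] and gD = bilipschitz_mapsD[OF g]
  have AX: "?A a \<in> sets (P_X p)" for a by (simp add: sets_restrict_space_iff)
  have pointwise: "ennreal (\<bar>?u y $ j\<bar>\<^sup>2) \<le> (\<Sum>a\<in>grid m. ennreal (?w a) * indicator (?A a) y)"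
    if y: "y \<in> square" for y j
  proof -
    \<comment> \<open>With \<open>y = g x\<close> and v the preimage of y under f, the error at y is
      \<open>x - v\<close>. Since \<open>f v = g x\<close>, the Lipschitz inverse of f bounds it by
      \<open>2 * norm (f x - g x)\<close>, a forward error at x, which is then moved to the center
      of a cell containing x.\<close>
    obtain x where x: "x \<in> square" "y = g x" using gD(1) y by (auto simp: bij_betw_def)
    obtain a where a: "a \<in> grid m" "x \<in> cell m a" using cells_cover[OF m x(1)] .
    have t: "?t a \<in> square" using a(1) by (rule center_in_square)
    define v where "v = the_inv_into square f y"
    have fv: "f v = y" using fD(1) y unfolding v_def by (intro f_the_inv_into_f_bij_betw) auto
    have v: "v \<in> square" using bij_betw_the_inv_into[OF fD(1)] y unfolding v_def by (auto simp: bij_betw_def)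
    have d: "norm (x - ?t a) \<le> 2 * h" using cell_diameter[OF a(2)] by (simp add: h_def)
    have ft: "norm (f x - f (?t a)) \<le> 4 * h" and gt: "norm (g x - g (?t a)) \<le> 4 * h"
      using fD(2)[OF x(1) t] gD(2)[OF x(1) t] d by linarith+
    have xv': "norm (x - v) \<le> 2 * norm (f x - g x)" using fD(3)[OF x(1) v] by (simp add: fv x(2))
    have "norm (f x - g x) = norm ((f x - f (?t a)) - (g (?t a) - f (?t a)) - (g x - g (?t a)))" by simp
    also have "\<dots> \<le> norm (f x - f (?t a)) + ?d a + norm (g x - g (?t a))"
      using norm_triangle_ineq4[of "(f x - f (?t a)) - (g (?t a) - f (?t a))" "g x - g (?t a)"]
        norm_triangle_ineq4[of "f x - f (?t a)" "g (?t a) - f (?t a)"] by linarith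
    finally have "norm (f x - g x) \<le> norm (f x - f (?t a)) + ?d a + norm (g x - g (?t a))" .
    then have "norm (f x - g x) \<le> ?d a + 8 * h" using ft gt by linarith
    then have "2 * norm (f x - g x) \<le> 2 * (?d a + 8 * h)" by (rule mult_left_mono) simp
    with xv' have xv: "norm (x - v) \<le> 2 * (?d a + 8 * h)" by (rule order_trans)
    have "\<bar>?u y $ j\<bar> \<le> norm (x - v)"
      using component_le_norm_cart[of "x - v" j] by (simp add: x(2) quasi_inverse_eq[OF gD(1) x(1)] v_def)
    then have "\<bar>?u y $ j\<bar>\<^sup>2 \<le> (2 * (?d a + 8 * h))\<^sup>2" using xv by (intro power_mono) auto
    also have "\<dots> = 4 * (?d a + 8 * h)\<^sup>2" by (rule trans[OF power_mult_distrib]) simp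
    also have "\<dots> \<le> 4 * (2 * (?d a)\<^sup>2 + 2 * (8 * h)\<^sup>2)" by (intro mult_left_mono add_sq_le) auto
    also have "\<dots> = ?w a" by (simp add: power_mult_distrib)
    finally have le: "ennreal (\<bar>?u y $ j\<bar>\<^sup>2) \<le> ennreal (?w a)" by (rule ennreal_leI)
    have "\<bar>(y - g (?t a)) $ i\<bar> \<le> 4 * h" for i
      using component_le_norm_cart[of "y - g (?t a)" i] gt by (simp add: x(2))
    then have "y \<in> ?A a" using y by (simp add: box_around_def)
    then have "ennreal (\<bar>?u y $ j\<bar>\<^sup>2) \<le> ennreal (?w a) * indicator (?A a) y" using le by simp
    also have "\<dots> \<le> (\<Sum>a\<in>grid m. ennreal (?w a) * indicator (?A a) y)"
      using a(1) by (intro member_le_sum) auto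
    finally show ?thesis .
  qed
  \<comment> \<open>The additive error \<open>h\<^sup>2\<close> is paid once per cell, which amounts
    to a constant. The boxes have area \<open>64 * h\<^sup>2\<close>, and
    \<open>64 * 8 = 512\<close>; the two components of the norm double this to 1024.\<close>
  have mh: "real (card (grid m)) * h\<^sup>2 = 1" using m by (simp add: card_grid h_def power_divide)
  have comp: "(\<integral>\<^sup>+ y. ennreal (\<bar>?u y $ j\<bar>\<^sup>2) \<partial>P_X p)
      \<le> ennreal (512 * B * h\<^sup>2 * ((\<Sum>a\<in>grid m. (?d a)\<^sup>2) + 64))" for j
  proof -
    have "(\<integral>\<^sup>+ y. ennreal (\<bar>?u y $ j\<bar>\<^sup>2) \<partial>P_X p) \<le> (\<integral>\<^sup>+ y. (\<Sum>a\<in>grid m. ennreal (?w a) * indicator (?A a) y) \<partial>P_X p)"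
      using pointwise by (intro nn_integral_mono) simp
    also have "\<dots> = (\<Sum>a\<in>grid m. \<integral>\<^sup>+ y. ennreal (?w a) * indicator (?A a) y \<partial>P_X p)"
      by (intro nn_integral_sum borel_measurable_times_ennreal borel_measurable_const borel_measurable_indicator AX)
    also have "\<dots> = (\<Sum>a\<in>grid m. ennreal (?w a) * emeasure (P_X p) (?A a))"
      by (intro sum.cong refl nn_integral_cmult_indicator AX)
    also have "\<dots> \<le> (\<Sum>a\<in>grid m. ennreal (?w a) * (ennreal B * ennreal ((2 * (4 * h))\<^sup>2)))"
    proof (intro sum_mono mult_left_mono)
      fix a
      have "emeasure (P_X p) (?A a) \<le> ennreal B * emeasure lborel (box_around (g (?t a)) (4 * h))"
        by (rule emeasure_P_X_le[OF p B(1) borel_box_around])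
      then show "emeasure (P_X p) (?A a) \<le> ennreal B * ennreal ((2 * (4 * h))\<^sup>2)"
        using h by (simp add: emeasure_box_around)
    qed simp
    also have "\<dots> = (\<Sum>a\<in>grid m. ennreal (?w a * (B * (2 * (4 * h))\<^sup>2)))"
      using B(2) by (intro sum.cong refl) (simp add: ennreal_mult)
    also have "\<dots> = ennreal (\<Sum>a\<in>grid m. ?w a * (B * (2 * (4 * h))\<^sup>2))"
      using B(2) by (intro sum_ennreal) auto
    also have "(\<Sum>a\<in>grid m. ?w a * (B * (2 * (4 * h))\<^sup>2)) = 64 * B * h\<^sup>2 * (\<Sum>a\<in>grid m. ?w a)"
      by (simp add: sum_distrib_left power_mult_distrib mult_ac)
    also have "(\<Sum>a\<in>grid m. ?w a) = 8 * (\<Sum>a\<in>grid m. (?d a)\<^sup>2) + 512 * (real (card (grid m)) * h\<^sup>2)"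
      by (simp add: sum.distrib sum_distrib_left)
    finally show ?thesis unfolding mh by (simp add: algebra_simps)
  qed
  have "L2_norm_sq (P_X p) ?u \<le> (\<Sum>j\<in>(UNIV :: 2 set). ennreal (512 * B * h\<^sup>2 * ((\<Sum>a\<in>grid m. (?d a)\<^sup>2) + 64)))"
    unfolding L2_norm_sq_def by (intro sum_mono comp)
  also have "\<dots> = ennreal (\<Sum>j\<in>(UNIV :: 2 set). 512 * B * h\<^sup>2 * ((\<Sum>a\<in>grid m. (?d a)\<^sup>2) + 64))"
    using B(2) by (intro sum_ennreal mult_nonneg_nonneg add_nonneg_nonneg sum_nonneg) auto
  also have "(\<Sum>j\<in>(UNIV :: 2 set). 512 * B * h\<^sup>2 * ((\<Sum>a\<in>grid m. (?d a)\<^sup>2) + 64))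
      = 1024 * B / (real m)\<^sup>2 * ((\<Sum>a\<in>grid m. (?d a)\<^sup>2) + 64)"
    by (simp add: h_def power_divide)
  finally show ?thesis .
qed

lemma finite_net:
  assumes m: "m > 0"
  shows "\<exists>(gs :: nat \<Rightarrow> real^2 \<Rightarrow> real^2) N. N > 0 \<and> (\<forall>k<N. gs k \<in> bilipschitz_maps) \<and>
    (\<forall>f\<in>bilipschitz_maps. \<exists>k<N. \<forall>a\<in>grid m. norm (gs k (center m a) - f (center m a)) \<le> 2 / m)"
proof -
  \<comment> \<open>The code of a map rounds its values at the centers down to multiples of
    \<open>1 / m\<close>. The values lie in the square, so finitely many codes occur, and maps with
    the same code differ by at most \<open>1 / m\<close> per coordinate at every center.\<close>
  define \<Phi> where "\<Phi> f = (\<lambda>a\<in>grid m. \<lambda>j. \<lfloor>f (center m a) $ j * m\<rfloor>)" for f :: "real^2 \<Rightarrow> real^2"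
  have "\<Phi> ` bilipschitz_maps \<subseteq> (grid m \<rightarrow>\<^sub>E (UNIV \<rightarrow>\<^sub>E {- int m..int m}))"
  proof
    fix v assume "v \<in> \<Phi> ` bilipschitz_maps"
    then obtain f where f: "f \<in> bilipschitz_maps" "v = \<Phi> f" by blast
    have "\<lfloor>f (center m a) $ j * m\<rfloor> \<in> {- int m..int m}" if "a \<in> grid m" for a j
    proof -
      have "f (center m a) \<in> square"
        using bilipschitz_mapsD(1)[OF f(1)] center_in_square[OF that] by (auto simp: bij_betw_def)
      then have b: "- 1 \<le> f (center m a) $ j" "f (center m a) $ j \<le> 1" by (auto simp: mem_square)
      have "- 1 * real m \<le> f (center m a) $ j * m" "f (center m a) $ j * m \<le> 1 * real m"
        using b by (intro mult_right_mono; simp)+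
      then show ?thesis by (simp add: le_floor_iff floor_le_iff)
    qed
    then show "v \<in> (grid m \<rightarrow>\<^sub>E (UNIV \<rightarrow>\<^sub>E {- int m..int m}))"
      unfolding f(2) \<Phi>_def by auto
  qed
  then have fin: "finite (\<Phi> ` bilipschitz_maps)"
    by (rule finite_subset) (intro finite_PiE finite_grid finite_atLeastAtMost_int; simp)
  \<comment> \<open>One representative per code is taken from the class itself rather than from the
    rounded values, so that every net element is invertible.\<close>
  define F where "F = inv_into bilipschitz_maps \<Phi> ` (\<Phi> ` bilipschitz_maps)"
  have finF: "finite F" unfolding F_def using fin by (rule finite_imageI)
  have FD: "F \<subseteq> bilipschitz_maps" unfolding F_def using inv_into_into[of _ \<Phi> bilipschitz_maps] by blast
  have close: "\<exists>g\<in>F. \<forall>a\<in>grid m. norm (g (center m a) - f (center m a)) \<le> 2 / m" if f: "f \<in> bilipschitz_maps" for f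
  proof (intro bexI ballI)
    let ?g = "inv_into bilipschitz_maps \<Phi> (\<Phi> f)"
    show "?g \<in> F" unfolding F_def using f by blast
    fix a assume a: "a \<in> grid m"
    have "\<Phi> ?g = \<Phi> f" by (rule f_inv_into_f[OF imageI[OF f]])
    then have "\<Phi> ?g a j = \<Phi> f a j" for j by simp
    then have eq: "\<lfloor>?g (center m a) $ j * m\<rfloor> = \<lfloor>f (center m a) $ j * m\<rfloor>" for j
      using a by (simp add: \<Phi>_def)
    have "\<bar>(?g (center m a) - f (center m a)) $ j\<bar> \<le> 1 / m" for j
    proof -
      have "\<bar>?g (center m a) $ j * m - f (center m a) $ j * m\<bar> \<le> 1" using eq[of j] by linarith
      moreover have "\<bar>x * m - y * m\<bar> = \<bar>x - y\<bar> * m" for x y :: real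
        by (simp only: left_diff_distrib[symmetric] abs_mult abs_of_nat)
      ultimately show ?thesis using m by (simp add: pos_le_divide_eq)
    qed
    from norm_le_box[OF this] show "norm (?g (center m a) - f (center m a)) \<le> 2 / m" by simp
  qed
  obtain gs :: "nat \<Rightarrow> real^2 \<Rightarrow> real^2" where gs: "F = gs ` {i. i < card F}"
    using finite_imp_nat_seg_image_inj_on[OF finF] card_image by (metis card_Collect_less_nat)
  show ?thesis
  proof (rule exI[of _ gs], rule exI[of _ "card F"], intro conjI allI impI ballI)
    show "card F > 0" using close[OF id_in_bilipschitz_maps] finF by (auto simp: card_gt_0_iff)
    show "gs k \<in> bilipschitz_maps" if "k < card F" for k using that FD gs by blast
    fix f assume "f \<in> bilipschitz_maps"
    then obtain g where g: "g \<in> F" "\<forall>a\<in>grid m. norm (g (center m a) - f (center m a)) \<le> 2 / m"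
      using close by blast
    then obtain k where "k < card F" "g = gs k" using gs by blast
    then show "\<exists>k<card F. \<forall>a\<in>grid m. norm (gs k (center m a) - f (center m a)) \<le> 2 / m"
      using g(2) by blast
  qed
qed

text \<open>Here g is the minimiser, \<open>g'\<close> a competitor near the target f, and
  \<open>\<theta>\<close> the noisy data. Passing from g to f through \<open>\<theta>\<close> costs
  a factor 2; minimality replaces g by \<open>g'\<close>, and passing back through f costs another
  factor 2. Thus \<open>6 = 2 + 2 * 2\<close> and \<open>4 = 2 * 2\<close>.\<close>

lemma minimum_contrast_bound:
  fixes \<theta> g f g' :: "'i \<Rightarrow> real^2"
  assumes min: "(\<Sum>a\<in>A. (norm (\<theta> a - g a))\<^sup>2) \<le> (\<Sum>a\<in>A. (norm (\<theta> a - g' a))\<^sup>2)"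
  shows "(\<Sum>a\<in>A. (norm (g a - f a))\<^sup>2) \<le> 6 * (\<Sum>a\<in>A. (norm (\<theta> a - f a))\<^sup>2) + 4 * (\<Sum>a\<in>A. (norm (g' a - f a))\<^sup>2)"
proof -
  have "(\<Sum>a\<in>A. (norm (g a - f a))\<^sup>2) \<le> (\<Sum>a\<in>A. 2 * (norm (\<theta> a - g a))\<^sup>2 + 2 * (norm (\<theta> a - f a))\<^sup>2)"
  proof (rule sum_mono)
    fix a
    have "g a - f a = (g a - \<theta> a) + (\<theta> a - f a)" by simp
    then show "(norm (g a - f a))\<^sup>2 \<le> 2 * (norm (\<theta> a - g a))\<^sup>2 + 2 * (norm (\<theta> a - f a))\<^sup>2"
      using norm_add_sq_le[of "g a - \<theta> a" "\<theta> a - f a"] by (simp add: norm_minus_commute[of "g a" "\<theta> a"])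
  qed
  also have "\<dots> = 2 * (\<Sum>a\<in>A. (norm (\<theta> a - g a))\<^sup>2) + 2 * (\<Sum>a\<in>A. (norm (\<theta> a - f a))\<^sup>2)"
    by (simp add: sum.distrib sum_distrib_left)
  finally have 1: "(\<Sum>a\<in>A. (norm (g a - f a))\<^sup>2)
     \<le> 2 * (\<Sum>a\<in>A. (norm (\<theta> a - g a))\<^sup>2) + 2 * (\<Sum>a\<in>A. (norm (\<theta> a - f a))\<^sup>2)" .
  have "(\<Sum>a\<in>A. (norm (\<theta> a - g' a))\<^sup>2) \<le> (\<Sum>a\<in>A. 2 * (norm (\<theta> a - f a))\<^sup>2 + 2 * (norm (g' a - f a))\<^sup>2)"
  proof (rule sum_mono)
    fix a
    have "\<theta> a - g' a = (\<theta> a - f a) + (f a - g' a)" by simp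
    then show "(norm (\<theta> a - g' a))\<^sup>2 \<le> 2 * (norm (\<theta> a - f a))\<^sup>2 + 2 * (norm (g' a - f a))\<^sup>2"
      using norm_add_sq_le[of "\<theta> a - f a" "f a - g' a"] by (simp add: norm_minus_commute[of "f a" "g' a"])
  qed
  also have "\<dots> = 2 * (\<Sum>a\<in>A. (norm (\<theta> a - f a))\<^sup>2) + 2 * (\<Sum>a\<in>A. (norm (g' a - f a))\<^sup>2)"
    by (simp add: sum.distrib sum_distrib_left)
  finally show ?thesis using 1 min by linarith
qed

section \<open>Risk bounds in the regression model\<close>

text \<open>Arithmetic for the risk bound, with M the number of cells per axis and s the noise
  variance. Inside the bracket stand the squared bias and the variance of one cell mean;
  \<open>57600 = 16 * 3600\<close> and \<open>294912000 = 81920 * 3600\<close> come from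
  \<open>1 / M \<le> 60 * r\<close>.\<close>

lemma risk_bound_constant:
  fixes M B r s :: real
  assumes "0 \<le> B" "0 < M" "1 / M \<le> 60 * r" "0 < s"
  shows "6144 * B / M\<^sup>2 * (2 * M\<^sup>2 * ((4 / M)\<^sup>2 + 36 * (1 + s) * r\<^sup>2 / s)) + 81920 * B / M\<^sup>2
    \<le> (12288 * B * (57600 + 36 * (1 + s) / s) + 294912000 * B) * r\<^sup>2"
proof -
  have "(1 / M)\<^sup>2 \<le> (60 * r)\<^sup>2" using assms by (intro power_mono) auto
  then have M: "1 / M\<^sup>2 \<le> 3600 * r\<^sup>2" by (simp add: power_divide power_mult_distrib)
  have "6144 * B / M\<^sup>2 * (2 * M\<^sup>2 * ((4 / M)\<^sup>2 + 36 * (1 + s) * r\<^sup>2 / s)) + 81920 * B / M\<^sup>2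
     = 12288 * B * (16 * (1 / M\<^sup>2) + 36 * (1 + s) / s * r\<^sup>2) + 81920 * B * (1 / M\<^sup>2)"
    using assms(2) by (simp add: power_divide)
  also have "\<dots> \<le> 12288 * B * (16 * (3600 * r\<^sup>2) + 36 * (1 + s) / s * r\<^sup>2) + 81920 * B * (3600 * r\<^sup>2)"
    using M assms(1) by (intro add_right_mono add_mono mult_left_mono) auto
  also have "\<dots> = (12288 * B * (57600 + 36 * (1 + s) / s) + 294912000 * B) * r\<^sup>2"
    by (simp add: algebra_simps)
  finally show ?thesis .
qed

locale regression_model =
  fixes p :: "real^2 \<Rightarrow> real" and \<sigma> :: real
  assumes design_prob: "prob_space (P_X p)" and \<sigma>_pos: "\<sigma> > 0"
begin

sublocale X: prob_space "P_X p" by (rule design_prob)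
sublocale N: prob_space "noise \<sigma>" using \<sigma>_pos by (rule prob_space_noise)
sublocale XN: pair_prob_space "P_X p" "noise \<sigma>" ..

lemma obs_map_measurable [measurable]:
  assumes [measurable]: "measurable_map f"
  shows "(\<lambda>(x, e). (x, f x + e)) \<in> P_X p \<Otimes>\<^sub>M noise \<sigma> \<rightarrow>\<^sub>M obs_space"
  by measurable

lemma prob_space_obs_law:
  assumes "measurable_map f" shows "prob_space (obs_law p \<sigma> f)"
  unfolding obs_law_def using assms by (intro XN.P.prob_space_distr obs_map_measurable)

lemma prob_space_sample_law:
  assumes "measurable_map f" shows "prob_space (sample_law p \<sigma> n f)"
  unfolding sample_law_def using assms by (intro prob_space_PiM prob_space_obs_law)

lemma nn_integral_obs_law:
  assumes [measurable]: "measurable_map f" "g \<in> borel_measurable obs_space"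
  shows "(\<integral>\<^sup>+ z. g z \<partial>obs_law p \<sigma> f) = (\<integral>\<^sup>+ x. \<integral>\<^sup>+ e. g (x, f x + e) \<partial>noise \<sigma> \<partial>P_X p)"
proof -
  have "(\<integral>\<^sup>+ z. g z \<partial>obs_law p \<sigma> f) = (\<integral>\<^sup>+ z. g (case z of (x, e) \<Rightarrow> (x, f x + e)) \<partial>(P_X p \<Otimes>\<^sub>M noise \<sigma>))"
    unfolding obs_law_def by (rule nn_integral_distr) measurable
  also have "\<dots> = (\<integral>\<^sup>+ x. \<integral>\<^sup>+ e. g (x, f x + e) \<partial>noise \<sigma> \<partial>P_X p)"
    by (subst N.nn_integral_fst[symmetric]) auto
  finally show ?thesis .
qed

text \<open>Translating the noise moves the regression function from the argument into the density.
  All observation laws then share one base measure and can be compared.\<close>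

lemma nn_integral_obs_law_density:
  assumes [measurable]: "measurable_map f" "g \<in> borel_measurable obs_space"
  shows "(\<integral>\<^sup>+ z. g z \<partial>obs_law p \<sigma> f) = (\<integral>\<^sup>+ x. \<integral>\<^sup>+ y. ennreal (gauss \<sigma> (y - f x)) * g (x, y) \<partial>lborel \<partial>P_X p)"
proof -
  have shift: "(\<integral>\<^sup>+ e. h (a + e) \<partial>noise \<sigma>) = (\<integral>\<^sup>+ y. ennreal (gauss \<sigma> (y - a)) * h y \<partial>lborel)"
    if [measurable]: "h \<in> borel_measurable borel" for h and a :: "real^2"
  proof -
    have "(\<integral>\<^sup>+ y. ennreal (gauss \<sigma> (y - a)) * h y \<partial>lborel)
       = (\<integral>\<^sup>+ y. ennreal (gauss \<sigma> (y - a)) * h y \<partial>distr lborel borel ((+) a))"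
      by (simp add: lborel_distr_plus)
    also have "\<dots> = (\<integral>\<^sup>+ e. ennreal (gauss \<sigma> e) * h (a + e) \<partial>lborel)"
      by (subst nn_integral_distr) simp_all
    also have "\<dots> = (\<integral>\<^sup>+ e. h (a + e) \<partial>noise \<sigma>)"
      unfolding noise_eq by (rule nn_integral_density[symmetric]) measurable
    finally show ?thesis by (rule sym)
  qed
  have "(\<integral>\<^sup>+ e. g (x, f x + e) \<partial>noise \<sigma>) = (\<integral>\<^sup>+ y. ennreal (gauss \<sigma> (y - f x)) * g (x, y) \<partial>lborel)"
    if "x \<in> space (P_X p)" for x
  proof (rule shift)
    have "x \<in> space (restrict_space borel square)" using that by (simp add: space_restrict_space)
    from measurable_compose[OF measurable_Pair1'[OF this] assms(2)]
    show "(\<lambda>y. g (x, y)) \<in> borel_measurable borel" .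
  qed
  then show ?thesis
    unfolding nn_integral_obs_law[OF assms] by (rule nn_integral_cong)
qed

section \<open>Likelihood ratios and the chi-square two-point bound\<close>

definition lik_ratio :: "(real^2 \<Rightarrow> real^2) \<Rightarrow> (real^2 \<Rightarrow> real^2) \<Rightarrow> (real^2) \<times> (real^2) \<Rightarrow> real" where
  "lik_ratio f f' = (\<lambda>(x, y). exp (((norm (y - f x))\<^sup>2 - (norm (y - f' x))\<^sup>2) / (2 * \<sigma>\<^sup>2)))"

lemma lik_ratio_measurable [measurable]:
  assumes [measurable]: "measurable_map f" "measurable_map f'"
  shows "lik_ratio f f' \<in> borel_measurable obs_space"
  unfolding lik_ratio_def by measurable

lemma gauss_lik_ratio: "gauss \<sigma> (y - f x) * lik_ratio f f' (x, y) = gauss \<sigma> (y - f' x)"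
proof -
  have "- (norm (y - f x))\<^sup>2 / (2 * \<sigma>\<^sup>2) + ((norm (y - f x))\<^sup>2 - (norm (y - f' x))\<^sup>2) / (2 * \<sigma>\<^sup>2)
      = - (norm (y - f' x))\<^sup>2 / (2 * \<sigma>\<^sup>2)"
    by (simp add: diff_divide_distrib)
  then show ?thesis by (simp add: gauss_def lik_ratio_def exp_add[symmetric])
qed

text \<open>The design law is common to both models and cancels, so the ratio of the two Gaussian
  densities of the response is the whole Radon-Nikodym derivative.\<close>

lemma obs_law_change:
  assumes [measurable]: "measurable_map f" "measurable_map f'"
  shows "obs_law p \<sigma> f' = density (obs_law p \<sigma> f) (lik_ratio f f')"
proof (rule measure_eqI)
  fix A assume "A \<in> sets (obs_law p \<sigma> f')"
  then have [measurable]: "A \<in> sets obs_space" by simp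
  have "emeasure (density (obs_law p \<sigma> f) (lik_ratio f f')) A
      = (\<integral>\<^sup>+ z. ennreal (lik_ratio f f' z) * indicator A z \<partial>obs_law p \<sigma> f)"
    by (rule emeasure_density) auto
  also have "\<dots> = (\<integral>\<^sup>+ x. \<integral>\<^sup>+ y. ennreal (gauss \<sigma> (y - f x)) *
       (ennreal (lik_ratio f f' (x, y)) * indicator A (x, y)) \<partial>lborel \<partial>P_X p)"
    by (rule nn_integral_obs_law_density) measurable
  also have "\<dots> = (\<integral>\<^sup>+ x. \<integral>\<^sup>+ y. ennreal (gauss \<sigma> (y - f' x)) * indicator A (x, y) \<partial>lborel \<partial>P_X p)"
    by (simp add: mult.assoc[symmetric] ennreal_mult'[symmetric] gauss_lik_ratio)
  also have "\<dots> = (\<integral>\<^sup>+ z. indicator A z \<partial>obs_law p \<sigma> f')"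
    by (rule nn_integral_obs_law_density[symmetric]) measurable
  also have "\<dots> = emeasure (obs_law p \<sigma> f') A" by simp
  finally show "emeasure (obs_law p \<sigma> f') A = emeasure (density (obs_law p \<sigma> f) (lik_ratio f f')) A" ..
qed simp

text \<open>Completing the square: the squared density at \<open>f' x\<close> divided by the density
  at \<open>f x\<close> is again Gaussian, centered at the reflection
  \<open>2 *\<^sub>R f' x - f x\<close>, up to an explicit factor. Its integral over y is therefore
  that factor.\<close>

lemma gauss_lik_ratio_sq:
  "gauss \<sigma> (y - f x) * (lik_ratio f f' (x, y))\<^sup>2
    = exp ((norm (f' x - f x))\<^sup>2 / \<sigma>\<^sup>2) * gauss \<sigma> (y - (2 *\<^sub>R f' x - f x))"
proof -
  have n: "(norm (y - (2 *\<^sub>R f' x - f x)))\<^sup>2 = 2 * (norm (y - f' x))\<^sup>2 - (norm (y - f x))\<^sup>2 + 2 * (norm (f' x - f x))\<^sup>2"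
    by (simp add: power2_norm_eq_inner algebra_simps inner_commute)
  have e: "- a / (2 * s) + 2 * ((a - b) / (2 * s)) = d / s + - (2 * b - a + 2 * d) / (2 * s)"
    if "s > 0" for a b d s :: real
    using that by (simp add: field_simps)
  have sq: "exp u / k * (exp v)\<^sup>2 = exp (u + 2 * v) / k" for u v k :: real
    by (simp add: exp_add exp_double)
  have pr: "exp u * (exp v / k) = exp (u + v) / k" for u v k :: real
    by (simp add: exp_add)
  show ?thesis
    unfolding gauss_def lik_ratio_def n prod.case sq pr using \<sigma>_pos by (subst e) auto
qed

lemma nn_integral_lik_ratio_sq:
  assumes [measurable]: "measurable_map f" "measurable_map f'"
  shows "(\<integral>\<^sup>+ z. ennreal ((lik_ratio f f' z)\<^sup>2) \<partial>obs_law p \<sigma> f)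
    = (\<integral>\<^sup>+ x. ennreal (exp ((norm (f' x - f x))\<^sup>2 / \<sigma>\<^sup>2)) \<partial>P_X p)"
proof -
  have "(\<integral>\<^sup>+ z. ennreal ((lik_ratio f f' z)\<^sup>2) \<partial>obs_law p \<sigma> f)
     = (\<integral>\<^sup>+ x. \<integral>\<^sup>+ y. ennreal (gauss \<sigma> (y - f x)) * ennreal ((lik_ratio f f' (x, y))\<^sup>2) \<partial>lborel \<partial>P_X p)"
    by (rule nn_integral_obs_law_density) measurable
  also have "\<dots> = (\<integral>\<^sup>+ x. \<integral>\<^sup>+ y. ennreal (exp ((norm (f' x - f x))\<^sup>2 / \<sigma>\<^sup>2))
      * ennreal (gauss \<sigma> (y - (2 *\<^sub>R f' x - f x))) \<partial>lborel \<partial>P_X p)"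
    by (simp add: ennreal_mult'[symmetric] gauss_lik_ratio_sq)
  also have "\<dots> = (\<integral>\<^sup>+ x. ennreal (exp ((norm (f' x - f x))\<^sup>2 / \<sigma>\<^sup>2)) \<partial>P_X p)"
    by (subst nn_integral_cmult) (auto simp: nn_integral_gauss_shift \<sigma>_pos)
  finally show ?thesis .
qed

lemma sample_law_change:
  assumes [measurable]: "measurable_map f" "measurable_map f'"
  shows "sample_law p \<sigma> n f' = density (sample_law p \<sigma> n f) (\<lambda>D. \<Prod>i<n. ennreal (lik_ratio f f' (D i)))"
  unfolding sample_law_def obs_law_change[OF assms]
proof (rule PiM_density)
  show "sigma_finite_measure (obs_law p \<sigma> f)"
    by (rule prob_space_imp_sigma_finite, rule prob_space_obs_law) fact
  show "sigma_finite_measure (density (obs_law p \<sigma> f) (lik_ratio f f'))"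
    unfolding obs_law_change[OF assms, symmetric]
    by (rule prob_space_imp_sigma_finite, rule prob_space_obs_law) fact
qed simp_all

text \<open>The second moment of the likelihood ratio is 1 plus the chi-square divergence; unlike
  the total variation distance it is multiplicative over independent observations.\<close>

lemma nn_integral_sample_lik_ratio_sq:
  assumes [measurable]: "measurable_map f" "measurable_map f'"
  shows "(\<integral>\<^sup>+ D. (\<Prod>i<n. ennreal (lik_ratio f f' (D i)))\<^sup>2 \<partial>sample_law p \<sigma> n f)
    = (\<integral>\<^sup>+ x. ennreal (exp ((norm (f' x - f x))\<^sup>2 / \<sigma>\<^sup>2)) \<partial>P_X p) ^ n"
proof -
  interpret product_sigma_finite "\<lambda>_. obs_law p \<sigma> f"
    unfolding product_sigma_finite_def
    by (intro allI prob_space_imp_sigma_finite prob_space_obs_law) fact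
  have nn: "0 \<le> lik_ratio f f' z" for z by (simp add: lik_ratio_def split: prod.split)
  have "(\<integral>\<^sup>+ D. (\<Prod>i<n. ennreal (lik_ratio f f' (D i)))\<^sup>2 \<partial>sample_law p \<sigma> n f)
     = (\<integral>\<^sup>+ D. (\<Prod>i<n. ennreal ((lik_ratio f f' (D i))\<^sup>2)) \<partial>sample_law p \<sigma> n f)"
    by (intro nn_integral_cong) (simp add: prod_power_distrib ennreal_power nn)
  also have "\<dots> = (\<Prod>i<n. \<integral>\<^sup>+ z. ennreal ((lik_ratio f f' z)\<^sup>2) \<partial>obs_law p \<sigma> f)"
    unfolding sample_law_def by (rule product_nn_integral_prod) auto
  finally show ?thesis by (simp add: nn_integral_lik_ratio_sq)
qed

text \<open>Disjointness gives E1 mass at most 1/4 under f, while it has mass at least 3/4 under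
  \<open>f'\<close>. A change of measure this strong forces the second moment of the likelihood
  ratio up to 9/4.\<close>

lemma two_point_chi_square:
  assumes [measurable]: "measurable_map f" "measurable_map f'"
    and E0: "E0 \<in> sets (sample_space n)" "emeasure (sample_law p \<sigma> n f) E0 \<ge> ennreal (3/4)"
    and E1: "E1 \<in> sets (sample_space n)" "emeasure (sample_law p \<sigma> n f') E1 \<ge> ennreal (3/4)"
    and disj: "E0 \<inter> E1 = {}"
  shows "(\<integral>\<^sup>+ x. ennreal (exp ((norm (f' x - f x))\<^sup>2 / \<sigma>\<^sup>2)) \<partial>P_X p) ^ n \<ge> ennreal (9/4)"
proof -
  let ?M = "sample_law p \<sigma> n f" and ?W = "\<lambda>D. \<Prod>i<n. ennreal (lik_ratio f f' (D i))"
  let ?\<chi> = "(\<integral>\<^sup>+ x. ennreal (exp ((norm (f' x - f x))\<^sup>2 / \<sigma>\<^sup>2)) \<partial>P_X p) ^ n"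
  interpret S: prob_space ?M by (rule prob_space_sample_law) fact
  note [measurable] = E0(1) E1(1)
  have "emeasure ?M E0 + emeasure ?M E1 = emeasure ?M (E0 \<union> E1)"
    by (rule plus_emeasure) (use disj in auto)
  also have "\<dots> \<le> 1" by (rule S.emeasure_le_1)
  finally have "S.prob E0 + S.prob E1 \<le> 1"
    by (simp add: S.emeasure_eq_measure ennreal_plus[symmetric] del: ennreal_plus)
  moreover have "S.prob E0 \<ge> 3/4"
    using E0(2) unfolding S.emeasure_eq_measure by (subst (asm) ennreal_le_iff) auto
  ultimately have p: "S.prob E1 \<le> 1/4" by linarith
  have "ennreal (3/4) \<le> emeasure (sample_law p \<sigma> n f') E1" by fact
  also have "\<dots> = (\<integral>\<^sup>+ D. ?W D * indicator E1 D \<partial>?M)"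
    unfolding sample_law_change[OF assms(1,2)] by (rule emeasure_density) auto
  also have "\<dots> \<le> (\<integral>\<^sup>+ D. ennreal (1/6) * (?W D)\<^sup>2 + ennreal (3/2) * indicator E1 D \<partial>?M)"
    by (intro nn_integral_mono weighted_am_gm)
  also have "\<dots> = ennreal (1/6) * ?\<chi> + ennreal (3/2) * emeasure ?M E1"
    by (subst nn_integral_add)
       (simp_all add: nn_integral_cmult nn_integral_sample_lik_ratio_sq)
  also have "\<dots> \<le> ennreal (1/6) * ?\<chi> + ennreal (3/8)"
    using p by (intro add_left_mono)
      (simp add: S.emeasure_eq_measure ennreal_mult'[symmetric] ennreal_leI)
  finally show ?thesis by (rule chi_square_bound)
qed

text \<open>The success probability refers to the completed law, whereas the change of measure needs
  an event of the product sigma-algebra. The main part of a completion-measurable set is such an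
  event, with the same mass.\<close>

lemma success_event:
  assumes "Linf_error_prob p \<sigma> n g f r \<ge> 3/4"
  obtains E where "E \<in> sets (sample_space n)" "emeasure (sample_law p \<sigma> n f) E \<ge> ennreal (3/4)"
    "\<And>D. D \<in> E \<Longrightarrow> Linf_norm (\<lambda>x. g D x - f x) \<le> ennreal r"
proof -
  let ?M = "sample_law p \<sigma> n f"
  let ?E = "{D \<in> space ?M. Linf_norm (\<lambda>x. g D x - f x) \<le> ennreal r}"
  have ge: "measure (completion ?M) ?E \<ge> 3/4" using assms by (simp add: Linf_error_prob_def)
  \<comment> \<open>A set outside the sigma-algebra gets the default measure 0, so a probability of
    at least 3/4 already implies measurability.\<close>
  then have E: "?E \<in> sets (completion ?M)"
    using measure_notin_sets[of ?E "completion ?M"] by (cases "?E \<in> sets (completion ?M)") auto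
  show ?thesis
  proof
    show "main_part ?M ?E \<in> sets (sample_space n)" using main_part_sets[OF E] by simp
    have "ennreal (3/4) \<le> ennreal (measure (completion ?M) ?E)" using ge by (rule ennreal_leI)
    also have "\<dots> \<le> emeasure (completion ?M) ?E"
      by (cases "emeasure (completion ?M) ?E") (auto simp: measure_def)
    also have "\<dots> = emeasure ?M (main_part ?M ?E)" using E by (rule emeasure_completion)
    finally show "ennreal (3/4) \<le> emeasure ?M (main_part ?M ?E)" .
    show "Linf_norm (\<lambda>x. g D x - f x) \<le> ennreal r" if "D \<in> main_part ?M ?E" for D
      using that main_part_null_part_Un[OF E] by blast
  qed
qed

text \<open>The identity and its bump perturbation differ only inside the box, where the exponent of
  the chi-square integrand is at most \<open>s = 9 * r\<^sup>2 / \<sigma>\<^sup>2\<close>. With q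
  the mass of the box, one observation contributes at most
  \<open>1 + 2 * s * q \<le> exp (2 * s * q)\<close>, and the sample its n-th power. A small q would
  make the two laws indistinguishable, contrary to the pilot's success under both.\<close>

lemma cell_mass_lower_bound:
  assumes pilot: "\<And>f. f \<in> bilipschitz_maps \<Longrightarrow> Linf_error_prob p \<sigma> n g f r \<ge> 3/4"
    and r: "0 < r" "3 * r \<le> \<sigma>" "30 * r \<le> h" and box: "box_around t h \<subseteq> square"
  shows "\<sigma>\<^sup>2 / 36 \<le> n * r\<^sup>2 * measure (P_X p) (box_around t h)"
proof -
  let ?Q = "box_around t h"
  define q where "q = measure (P_X p) ?Q"
  let ?b = "\<lambda>x. max 0 (3 * r - norm (x - t) / 10) *\<^sub>R axis 1 1 :: real^2"
  let ?f = "\<lambda>x. x + ?b x"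
  have Q [measurable]: "?Q \<in> sets (P_X p)"
    using box by (simp add: sets_restrict_space_iff)
  have t: "t \<in> square"
    using box r by (intro subsetD[OF box]) (auto simp: box_around_def)
  have f: "?f \<in> bilipschitz_maps" by (rule bump_in_bilipschitz_maps[OF _ r(3) box]) (use r in auto)
  have bQ: "norm (?b x) \<le> 3 * r" "x \<notin> ?Q \<Longrightarrow> ?b x = 0" for x
  proof -
    show "norm (?b x) \<le> 3 * r" using r by (simp add: norm_axis_1)
    assume "x \<notin> ?Q"
    then obtain j where "\<bar>(x - t) $ j\<bar> > h" by (auto simp: box_around_def not_le)
    then have "norm (x - t) \<ge> h" using component_le_norm_cart[of "x - t" j] by simp
    then show "?b x = 0" using r by simp
  qed
  obtain E0 where E0: "E0 \<in> sets (sample_space n)" "emeasure (sample_law p \<sigma> n (\<lambda>x. x)) E0 \<ge> ennreal (3/4)"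
    "\<And>D. D \<in> E0 \<Longrightarrow> Linf_norm (\<lambda>x. g D x - x) \<le> ennreal r"
    using success_event[OF pilot[OF id_in_bilipschitz_maps]] by blast
  obtain E1 where E1: "E1 \<in> sets (sample_space n)" "emeasure (sample_law p \<sigma> n ?f) E1 \<ge> ennreal (3/4)"
    "\<And>D. D \<in> E1 \<Longrightarrow> Linf_norm (\<lambda>x. g D x - ?f x) \<le> ennreal r"
    using success_event[OF pilot[OF f]] by blast
  \<comment> \<open>At the peak t the two regression functions differ by \<open>3 * r\<close> in the
    first coordinate, so no value can be within r of both.\<close>
  have "E0 \<inter> E1 = {}"
  proof (rule ccontr)
    assume "E0 \<inter> E1 \<noteq> {}"
    then obtain D where D: "D \<in> E0" "D \<in> E1" by blast
    have "\<bar>(g D t - t) $ 1\<bar> \<le> r" "\<bar>(g D t - ?f t) $ 1\<bar> \<le> r"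
      using Linf_normD[OF E0(3)[OF D(1)] _ t, of 1] Linf_normD[OF E1(3)[OF D(2)] _ t, of 1] r by auto
    then show False using r by (simp add: axis_def)
  qed
  from two_point_chi_square[OF bilipschitz_maps_measurable[OF id_in_bilipschitz_maps] bilipschitz_maps_measurable[OF f]
      E0(1,2) E1(1,2) this]
  have chi: "ennreal (9/4) \<le> (\<integral>\<^sup>+ x. ennreal (exp ((norm (?b x))\<^sup>2 / \<sigma>\<^sup>2)) \<partial>P_X p) ^ n"
    by simp
  \<comment> \<open>The condition \<open>3 * r \<le> \<sigma>\<close> is exactly
    \<open>s \<le> 1\<close>, the range in which \<open>exp s \<le> 1 + 2 * s\<close> follows from
    the quadratic bound on the exponential.\<close>
  define s where "s = 9 * r\<^sup>2 / \<sigma>\<^sup>2"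
  have s: "0 \<le> s" "s \<le> 1"
  proof -
    have "(3 * r)\<^sup>2 \<le> \<sigma>\<^sup>2" using r by (intro power_mono) auto
    then show "0 \<le> s" "s \<le> 1" using \<sigma>_pos by (auto simp: s_def power_mult_distrib)
  qed
  have exps: "exp s \<le> 1 + 2 * s"
  proof -
    have "exp s \<le> 1 + s + s\<^sup>2" using s by (rule exp_bound)
    also have "s\<^sup>2 \<le> s" using s by (simp add: power2_eq_square mult_left_le)
    finally show ?thesis by simp
  qed
  have "(\<integral>\<^sup>+ x. ennreal (exp ((norm (?b x))\<^sup>2 / \<sigma>\<^sup>2)) \<partial>P_X p)
      \<le> (\<integral>\<^sup>+ x. 1 + ennreal (2 * s) * indicator ?Q x \<partial>P_X p)"
  proof (rule nn_integral_mono)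
    fix x
    show "ennreal (exp ((norm (?b x))\<^sup>2 / \<sigma>\<^sup>2)) \<le> 1 + ennreal (2 * s) * indicator ?Q x"
    proof (cases "x \<in> ?Q")
      case True
      have "(norm (?b x))\<^sup>2 \<le> (3 * r)\<^sup>2" by (intro power_mono bQ) auto
      then have "(norm (?b x))\<^sup>2 / \<sigma>\<^sup>2 \<le> s"
        unfolding s_def by (intro divide_right_mono) (auto simp: power_mult_distrib)
      then have "exp ((norm (?b x))\<^sup>2 / \<sigma>\<^sup>2) \<le> 1 + 2 * s" using exps by (meson exp_le_cancel_iff order_trans)
      then have "ennreal (exp ((norm (?b x))\<^sup>2 / \<sigma>\<^sup>2)) \<le> ennreal (1 + 2 * s)" by (rule ennreal_leI)
      also have "\<dots> = 1 + ennreal (2 * s)" using s by (subst ennreal_plus) auto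
      finally show ?thesis using True by simp
    next
      case False
      then show ?thesis using bQ(2)[OF False] by simp
    qed
  qed
  also have "\<dots> = 1 + ennreal (2 * s) * emeasure (P_X p) ?Q"
    by (subst nn_integral_add) (auto simp: nn_integral_cmult nn_integral_indicator[OF Q] X.emeasure_space_1[simplified])
  also have "\<dots> = ennreal (1 + 2 * s * q)"
    using s by (subst ennreal_plus) (auto simp: q_def X.emeasure_eq_measure ennreal_mult')
  also have "\<dots> \<le> ennreal (exp (2 * s * q))" by (intro ennreal_leI exp_ge_add_one_self)
  finally have "(\<integral>\<^sup>+ x. ennreal (exp ((norm (?b x))\<^sup>2 / \<sigma>\<^sup>2)) \<partial>P_X p) ^ n \<le> ennreal (exp (2 * s * q)) ^ n"
    by (rule power_mono) simp
  also have "\<dots> = ennreal (exp (n * (2 * s * q)))" by (simp add: ennreal_power exp_of_nat_mult)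
  finally have "ennreal (9/4) \<le> ennreal (exp (n * (2 * s * q)))" by (rule order_trans[OF chi])
  then have ge: "9/4 \<le> exp (n * (2 * s * q))" by (subst (asm) ennreal_le_iff) auto
  \<comment> \<open>The exponential of 1/2 is at most 7/4, below 9/4. Solving
    \<open>n * 18 * r\<^sup>2 * q / \<sigma>\<^sup>2 \<ge> 1/2\<close> for the mass produces the
    constant 36.\<close>
  have "1/2 \<le> n * (2 * s * q)"
  proof (rule ccontr)
    assume "\<not> ?thesis"
    then have "exp (n * (2 * s * q)) \<le> exp (1/2)" by simp
    also have "\<dots> \<le> 1 + 1/2 + (1/2)\<^sup>2" by (rule exp_bound) auto
    finally show False using ge by (simp add: power2_eq_square)
  qed
  then show ?thesis
    using \<sigma>_pos unfolding s_def q_def by (simp add: field_simps)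
qed

text \<open>Dividing by the expected number of observations in Q rather than by the observed one
  makes this an exact average of i.i.d. terms: there is no random denominator and no empty-cell
  case.\<close>

definition cell_mean :: "nat \<Rightarrow> (real^2) set \<Rightarrow> (nat \<Rightarrow> (real^2) \<times> (real^2)) \<Rightarrow> real^2" where
  "cell_mean n Q D = (1 / (n * measure (P_X p) Q)) *\<^sub>R (\<Sum>i<n. indicator Q (fst (D i)) *\<^sub>R snd (D i))"

text \<open>The mean of one weighted term is the average of the j-th component of f over Q with
  respect to the design, hence within b of a. Its variance is at most its second moment, which is
  the integral of \<open>(f x $ j)\<^sup>2 + \<sigma>\<^sup>2\<close> over Q divided by the squared
  mass, so at most \<open>(1 + \<sigma>\<^sup>2)\<close> over the mass.\<close>

lemma cell_mean_mse:
  assumes f [measurable]: "measurable_map f" and f1: "\<And>x. x \<in> square \<Longrightarrow> \<bar>f x $ j\<bar> \<le> 1"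
    and Q: "Q \<in> sets borel" "Q \<subseteq> square" and q: "measure (P_X p) Q > 0" and n: "n > 0"
    and near: "\<And>x. x \<in> Q \<Longrightarrow> \<bar>f x $ j - a\<bar> \<le> b"
  shows "(\<integral>\<^sup>+ D. ennreal ((cell_mean n Q D $ j - a)\<^sup>2) \<partial>sample_law p \<sigma> n f)
      \<le> ennreal (b\<^sup>2 + (1 + \<sigma>\<^sup>2) / (n * measure (P_X p) Q))"
proof -
  define q where "q = measure (P_X p) Q"
  have q0: "q > 0" using q by (simp add: q_def)
  have QR [measurable]: "Q \<in> sets (restrict_space borel square)" using Q by (simp add: sets_restrict_space_iff)
  have QX: "Q \<in> sets (P_X p)" unfolding sets_P_X by (rule QR)
  define Z :: "(real^2) \<times> (real^2) \<Rightarrow> real" where "Z = (\<lambda>z. indicator Q (fst z) * (snd z $ j) / q)"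
  have Zm [measurable]: "Z \<in> borel_measurable obs_space"
    unfolding Z_def
    by (intro borel_measurable_divide borel_measurable_times borel_measurable_const
        measurable_compose[OF measurable_fst borel_measurable_indicator[OF QR]]
        measurable_compose[OF measurable_snd]) measurable
  let ?O = "obs_law p \<sigma> f"
  interpret O: prob_space ?O by (rule prob_space_obs_law) fact
  define w :: "real^2 \<Rightarrow> real" where "w x = indicator Q x / q" for x
  have w [measurable]: "w \<in> borel_measurable (restrict_space borel square)" unfolding w_def by measurable
  have w2: "(w x)\<^sup>2 = indicator Q x / q\<^sup>2" for x by (simp add: w_def indicator_def power_divide)
  \<comment> \<open>The weighted term in the coordinates (design point, noise), where the law is a
    product. Integrating the noise first removes the linear term and turns the quadratic one into
    \<open>\<sigma>\<^sup>2\<close>.\<close>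
  define Zf where "Zf = (\<lambda>(x, e). w x * (f x $ j + e $ j))"
  have Zf: "Z (x, f x + e) = Zf (x, e)" for x e
    by (simp add: Zf_def Z_def w_def)
  have Zf_eq: "Zf (x, e) = w x * f x $ j + w x * e $ j" for x e
    by (simp add: Zf_def distrib_left)
  have Zf2_eq: "(Zf (x, e))\<^sup>2 = (w x)\<^sup>2 * (f x $ j)\<^sup>2
      + (2 * (w x)\<^sup>2 * (f x $ j)) * e $ j + (w x)\<^sup>2 * (e $ j)\<^sup>2" for x e
    unfolding Zf_def prod.case power_mult_distrib power2_sum by (simp add: distrib_left)
  have ej: "(\<lambda>e::real^2. e $ j) \<in> borel_measurable borel"
    by (intro borel_measurable_continuous_onI continuous_intros)
  have fj: "(\<lambda>x. f x $ j) \<in> borel_measurable (restrict_space borel square)"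
    by (rule measurable_compose[OF f ej])
  have fstM: "fst \<in> P_X p \<Otimes>\<^sub>M noise \<sigma> \<rightarrow>\<^sub>M restrict_space borel square"
    using measurable_fst[of "P_X p" "noise \<sigma>"] by (simp only: measurable_cong_sets[OF refl sets_P_X])
  have sndM: "snd \<in> P_X p \<Otimes>\<^sub>M noise \<sigma> \<rightarrow>\<^sub>M borel"
    using measurable_snd[of "P_X p" "noise \<sigma>"] by (simp only: measurable_cong_sets[OF refl sets_noise])
  have Zf_meas: "Zf \<in> borel_measurable (P_X p \<Otimes>\<^sub>M noise \<sigma>)"
    unfolding Zf_def case_prod_unfold
    by (intro borel_measurable_times borel_measurable_add measurable_compose[OF fstM w]
        measurable_compose[OF fstM fj] measurable_compose[OF sndM ej])
  note mom = noise_moments[OF \<sigma>_pos]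
  have N1: "N.prob UNIV = 1" using N.prob_space by simp
  have in1: "(\<integral>e. Zf (x, e) \<partial>noise \<sigma>) = w x * f x $ j" for x
    unfolding Zf_eq using mom by (simp add: N1)
  have in2: "integrable (noise \<sigma>) (\<lambda>e. (Zf (x, e))\<^sup>2)"
    "(\<integral>e. (Zf (x, e))\<^sup>2 \<partial>noise \<sigma>) = indicator Q x / q\<^sup>2 * ((f x $ j)\<^sup>2 + \<sigma>\<^sup>2)" for x
  proof -
    show "integrable (noise \<sigma>) (\<lambda>e. (Zf (x, e))\<^sup>2)" unfolding Zf2_eq using mom by simp
    have "(\<integral>e. (Zf (x, e))\<^sup>2 \<partial>noise \<sigma>) = (w x)\<^sup>2 * (f x $ j)\<^sup>2 + (w x)\<^sup>2 * \<sigma>\<^sup>2"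
      unfolding Zf2_eq using mom by (simp add: N1)
    then show "(\<integral>e. (Zf (x, e))\<^sup>2 \<partial>noise \<sigma>) = indicator Q x / q\<^sup>2 * ((f x $ j)\<^sup>2 + \<sigma>\<^sup>2)"
      by (simp only: w2 distrib_left)
  qed
  have fj2: "(f x $ j)\<^sup>2 \<le> 1" if "x \<in> square" for x
    using f1[OF that] by (simp add: abs_square_le_1)
  have indQ: "integrable (P_X p) (\<lambda>x. indicator Q x :: real)"
    by (intro integrable_real_indicator QX) (simp add: X.emeasure_eq_measure)
  have ind: "integrable (P_X p) (\<lambda>x. indicator Q x / q\<^sup>2 * (1 + \<sigma>\<^sup>2))"
    by (intro integrable_mult_left integrable_divide_zero indQ)
  have le: "indicator Q x / q\<^sup>2 * ((f x $ j)\<^sup>2 + \<sigma>\<^sup>2) \<le> indicator Q x / q\<^sup>2 * (1 + \<sigma>\<^sup>2)" if "x \<in> square" for x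
    by (intro mult_left_mono add_right_mono fj2 that) simp
  have bound2: "integrable (P_X p) (\<lambda>x. indicator Q x / q\<^sup>2 * ((f x $ j)\<^sup>2 + \<sigma>\<^sup>2))"
  proof (rule Bochner_Integration.integrable_bound[OF ind])
    show "AE x in P_X p. norm (indicator Q x / q\<^sup>2 * ((f x $ j)\<^sup>2 + \<sigma>\<^sup>2)) \<le> norm (indicator Q x / q\<^sup>2 * (1 + \<sigma>\<^sup>2))"
    proof (rule AE_I2)
      fix x assume "x \<in> space (P_X p)"
      then have x: "x \<in> square" by simp
      have "0 \<le> indicator Q x / q\<^sup>2 * ((f x $ j)\<^sup>2 + \<sigma>\<^sup>2)" by simp
      then show "norm (indicator Q x / q\<^sup>2 * ((f x $ j)\<^sup>2 + \<sigma>\<^sup>2)) \<le> norm (indicator Q x / q\<^sup>2 * (1 + \<sigma>\<^sup>2))"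
        using le[OF x] unfolding real_norm_def by linarith
    qed
    show "(\<lambda>x. indicator Q x / q\<^sup>2 * ((f x $ j)\<^sup>2 + \<sigma>\<^sup>2)) \<in> borel_measurable (P_X p)"
      unfolding measurable_cong_sets[OF sets_P_X refl] by (intro borel_measurable_times borel_measurable_add
        borel_measurable_divide borel_measurable_power borel_measurable_const fj borel_measurable_indicator QR)
  qed
  have sq_int: "integrable (P_X p \<Otimes>\<^sub>M noise \<sigma>) (\<lambda>w. (Zf w)\<^sup>2)"
  proof (rule XN.Fubini_integrable)
    show "integrable (P_X p) (\<lambda>x. \<integral>e. norm ((Zf (x, e))\<^sup>2) \<partial>noise \<sigma>)"
      using bound2 by (simp add: in2)
    show "(\<lambda>w. (Zf w)\<^sup>2) \<in> borel_measurable (P_X p \<Otimes>\<^sub>M noise \<sigma>)"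
      by (rule borel_measurable_power) (rule Zf_meas)
  qed (simp add: in2)
  have int1: "integrable (P_X p \<Otimes>\<^sub>M noise \<sigma>) Zf"
    by (rule XN.P.square_integrable_imp_integrable[OF Zf_meas sq_int])
  have om [measurable]: "(\<lambda>(x, e). (x, f x + e)) \<in> P_X p \<Otimes>\<^sub>M noise \<sigma> \<rightarrow>\<^sub>M obs_space"
    by (rule obs_map_measurable) fact
  have Z2m: "(\<lambda>z. (Z z)\<^sup>2) \<in> borel_measurable obs_space" by (rule borel_measurable_power) (rule Zm)
  have Z2i: "integrable ?O (\<lambda>z. (Z z)\<^sup>2)"
    unfolding obs_law_def integrable_distr_eq[OF om Z2m] using sq_int by (simp add: Zf case_prod_unfold)
  have EZ: "integral\<^sup>L ?O Z = (\<integral>x. w x * f x $ j \<partial>P_X p)"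
  proof -
    have "integral\<^sup>L ?O Z = integral\<^sup>L (P_X p \<Otimes>\<^sub>M noise \<sigma>) Zf"
      unfolding obs_law_def integral_distr[OF om Zm] by (simp add: Zf case_prod_unfold)
    also have "\<dots> = (\<integral>x. \<integral>e. Zf (x, e) \<partial>noise \<sigma> \<partial>P_X p)"
      by (rule XN.integral_fst'[OF int1, symmetric])
    finally show ?thesis by (simp add: in1)
  qed
  have EZ2: "(\<integral>z. (Z z)\<^sup>2 \<partial>?O) \<le> (1 + \<sigma>\<^sup>2) / q"
  proof -
    have "(\<integral>z. (Z z)\<^sup>2 \<partial>?O) = (\<integral>w. (Zf w)\<^sup>2 \<partial>(P_X p \<Otimes>\<^sub>M noise \<sigma>))"
      unfolding obs_law_def integral_distr[OF om Z2m] by (simp add: Zf case_prod_unfold)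
    also have "\<dots> = (\<integral>x. \<integral>e. (Zf (x, e))\<^sup>2 \<partial>noise \<sigma> \<partial>P_X p)"
      by (rule XN.integral_fst'[OF sq_int, symmetric])
    also have "\<dots> = (\<integral>x. indicator Q x / q\<^sup>2 * ((f x $ j)\<^sup>2 + \<sigma>\<^sup>2) \<partial>P_X p)" by (simp add: in2)
    also have "\<dots> \<le> (\<integral>x. indicator Q x / q\<^sup>2 * (1 + \<sigma>\<^sup>2) \<partial>P_X p)"
      using le by (intro integral_mono bound2 ind) simp
    also have "\<dots> = q / q\<^sup>2 * (1 + \<sigma>\<^sup>2)" using Q(2) by (simp add: q_def Int_absorb2)
    also have "\<dots> = (1 + \<sigma>\<^sup>2) / q" using q0 by (simp add: power2_eq_square)
    finally show ?thesis .
  qed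
  have bi: "integrable (P_X p) (\<lambda>x. indicator Q x * (f x $ j))"
  proof (rule Bochner_Integration.integrable_bound[of _ "\<lambda>x. 1 :: real"])
    show "AE x in P_X p. norm (indicator Q x * (f x $ j)) \<le> norm (1::real)"
      using f1 by (intro AE_I2) (auto simp: indicator_def)
    show "(\<lambda>x. indicator Q x * (f x $ j)) \<in> borel_measurable (P_X p)"
      unfolding measurable_cong_sets[OF sets_P_X refl]
      by (intro borel_measurable_times fj borel_measurable_indicator QR)
  qed simp
  have bias: "\<bar>integral\<^sup>L ?O Z - a\<bar> \<le> b"
  proof -
    have "(\<integral>x. indicator Q x * (f x $ j) - indicator Q x * a \<partial>P_X p) = (\<integral>x. indicator Q x * (f x $ j) \<partial>P_X p) - q * a"
      using Q(2) by (subst Bochner_Integration.integral_diff[OF bi integrable_mult_left[OF indQ]])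
        (simp add: q_def Int_absorb2)
    moreover have "(\<integral>x. w x * f x $ j \<partial>P_X p) = (\<integral>x. indicator Q x * (f x $ j) \<partial>P_X p) / q"
      by (simp add: w_def)
    ultimately have "integral\<^sup>L ?O Z - a = (\<integral>x. indicator Q x * (f x $ j) - indicator Q x * a \<partial>P_X p) / q"
      using q0 by (simp add: EZ diff_divide_distrib)
    moreover have "\<bar>\<integral>x. indicator Q x * (f x $ j) - indicator Q x * a \<partial>P_X p\<bar> \<le> (\<integral>x. indicator Q x * b \<partial>P_X p)"
    proof (rule order_trans[OF integral_abs_bound], rule integral_mono)
      show "integrable (P_X p) (\<lambda>x. \<bar>indicator Q x * (f x $ j) - indicator Q x * a\<bar>)"
        by (intro integrable_abs Bochner_Integration.integrable_diff bi integrable_mult_left indQ)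
      show "integrable (P_X p) (\<lambda>x. indicator Q x * b)" by (intro integrable_mult_left indQ)
      show "\<bar>indicator Q x * (f x $ j) - indicator Q x * a\<bar> \<le> indicator Q x * b" for x
        using near[of x] by (auto simp: indicator_def)
    qed
    moreover have "(\<integral>x. indicator Q x * b \<partial>P_X p) = q * b"
      using Q(2) by (simp add: q_def Int_absorb2)
    moreover have "\<bar>e\<bar> \<le> b" if "e = i / q" "\<bar>i\<bar> \<le> k" "k = q * b" for e i k
      using that q0 by (simp add: abs_divide pos_divide_le_eq mult.commute)
    ultimately show ?thesis by blast
  qed
  have mean: "cell_mean n Q D $ j = (\<Sum>i<n. Z (D i)) / n" for D
    by (simp add: cell_mean_def Z_def q_def[symmetric] sum_divide_distrib[symmetric] mult.commute)
  have ZO: "Z \<in> borel_measurable ?O" unfolding measurable_cong_sets[OF sets_obs_law refl] by (rule Zm)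
  note mse = iid_mean_mse[OF O.prob_space_axioms ZO Z2i n, of a]
  have "(\<integral>\<^sup>+ D. ennreal ((cell_mean n Q D $ j - a)\<^sup>2) \<partial>sample_law p \<sigma> n f)
      = ennreal (\<integral>D. ((\<Sum>i<n. Z (D i)) / n - a)\<^sup>2 \<partial>PiM {..<n} (\<lambda>_. ?O))"
    unfolding mean sample_law_def by (rule nn_integral_eq_integral[OF mse(1)]) simp
  also have "\<dots> \<le> ennreal (b\<^sup>2 + (1 + \<sigma>\<^sup>2) / (n * q))"
    unfolding mse(2)
  proof (rule ennreal_leI, rule add_mono)
    show "(integral\<^sup>L ?O Z - a)\<^sup>2 \<le> b\<^sup>2" using power_mono[OF bias, of 2] by simp
    have "((\<integral>z. (Z z)\<^sup>2 \<partial>?O) - (integral\<^sup>L ?O Z)\<^sup>2) / n \<le> ((1 + \<sigma>\<^sup>2) / q) / n"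
      using EZ2 zero_le_power2[of "integral\<^sup>L ?O Z"] by (intro divide_right_mono; linarith)
    then show "((\<integral>z. (Z z)\<^sup>2 \<partial>?O) - (integral\<^sup>L ?O Z)\<^sup>2) / n \<le> (1 + \<sigma>\<^sup>2) / (n * q)"
      by (simp add: mult.commute)
  qed
  finally show ?thesis by (simp add: q_def)
qed

section \<open>Least squares over a finite net\<close>

lemma cell_mean_measurable:
  assumes "Q \<in> sets borel"
  shows "cell_mean n Q \<in> sample_space n \<rightarrow>\<^sub>M borel"
proof -
  have ind: "(indicator Q :: _ \<Rightarrow> real) \<in> borel_measurable (restrict_space borel square)"
    using assms by (intro measurable_restrict_space1 borel_measurable_indicator)
  have "(\<lambda>D. indicator Q (fst (D i)) *\<^sub>R snd (D i)) \<in> borel_measurable (sample_space n)" if "i < n" for i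
  proof -
    have D: "(\<lambda>D. D i) \<in> sample_space n \<rightarrow>\<^sub>M obs_space"
      using that by (intro measurable_component_singleton) auto
    show ?thesis
      by (intro borel_measurable_scaleR measurable_compose[OF measurable_compose[OF D measurable_fst] ind]
          measurable_compose[OF D measurable_snd])
  qed
  then have "(\<lambda>D. \<Sum>i<n. indicator Q (fst (D i)) *\<^sub>R snd (D i)) \<in> borel_measurable (sample_space n)"
    by (intro borel_measurable_sum) auto
  then show ?thesis
    unfolding cell_mean_def by (intro borel_measurable_scaleR borel_measurable_const)
qed

definition contrast :: "nat \<Rightarrow> nat \<Rightarrow> (nat \<Rightarrow> (real^2) \<times> (real^2)) \<Rightarrow> (real^2 \<Rightarrow> real^2) \<Rightarrow> real" where
  "contrast n m D g = (\<Sum>a\<in>grid m. (norm (cell_mean n (cell m a) D - g (center m a)))\<^sup>2)"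

text \<open>Taking the least minimising index settles ties measurably; finiteness of the net
  guarantees that a minimiser exists.\<close>

definition selection :: "nat \<Rightarrow> nat \<Rightarrow> (nat \<Rightarrow> real^2 \<Rightarrow> real^2) \<Rightarrow> nat \<Rightarrow> (nat \<Rightarrow> (real^2) \<times> (real^2)) \<Rightarrow> nat" where
  "selection n m gs N D = (LEAST k. k < N \<and> (\<forall>j<N. contrast n m D (gs k) \<le> contrast n m D (gs j)))"

lemma selection_minimises:
  assumes "N > 0"
  shows "selection n m gs N D < N"
    and "j < N \<Longrightarrow> contrast n m D (gs (selection n m gs N D)) \<le> contrast n m D (gs j)"
proof -
  have "\<exists>k. k < N \<and> (\<forall>j<N. contrast n m D (gs k) \<le> contrast n m D (gs j))"
  proof -
    let ?c = "\<lambda>k. contrast n m D (gs k)"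
    have "Min (?c ` {..<N}) \<in> ?c ` {..<N}" using assms by (intro Min_in) auto
    then obtain k where k: "k < N" "Min (?c ` {..<N}) = ?c k" by auto
    have "?c k \<le> ?c j" if "j < N" for j unfolding k(2)[symmetric] using that by (intro Min_le) auto
    then show ?thesis using k(1) by blast
  qed
  from LeastI_ex[OF this] show "selection n m gs N D < N"
    "j < N \<Longrightarrow> contrast n m D (gs (selection n m gs N D)) \<le> contrast n m D (gs j)"
    unfolding selection_def by blast+
qed

lemma selection_estimator:
  assumes N: "N > 0" and gs: "\<And>k. k < N \<Longrightarrow> gs k \<in> bilipschitz_maps"
  shows "(\<lambda>D. gs (selection n m gs N D)) \<in> estimators n"
proof -
  have cm: "(\<lambda>D. contrast n m D g) \<in> borel_measurable (sample_space n)" for g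
    unfolding contrast_def cell_def
    by (intro borel_measurable_sum borel_measurable_power measurable_compose[OF _ borel_measurable_norm]
        borel_measurable_diff cell_mean_measurable borel_box_around borel_measurable_const)
  have sel: "selection n m gs N \<in> sample_space n \<rightarrow>\<^sub>M count_space UNIV"
    unfolding selection_def
  proof (rule measurable_Least)
    fix k
    let ?S = "sample_space n"
    have "{D \<in> space ?S. \<forall>j\<in>{..<N}. contrast n m D (gs k) \<le> contrast n m D (gs j)} \<in> sets ?S"
      by (intro sets.sets_Collect_finite_All borel_measurable_le cm) auto
    note * = this[unfolded Ball_def lessThan_iff]
    have "{D \<in> space ?S. k < N \<and> (\<forall>j<N. contrast n m D (gs k) \<le> contrast n m D (gs j))} \<in> sets ?S"
    proof (cases "k < N")
      case True
      show ?thesis by (simp only: True simp_thms) (rule *)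
    next
      case False
      then have "{D \<in> space ?S. k < N \<and> (\<forall>j<N. contrast n m D (gs k) \<le> contrast n m D (gs j))} = {}" by blast
      then show ?thesis by (rule ssubst) (rule sets.empty_sets)
    qed
    then show "(\<lambda>D. k < N \<and> (\<forall>j<N. contrast n m D (gs k) \<le> contrast n m D (gs j))) \<in> ?S \<rightarrow>\<^sub>M count_space UNIV"
      unfolding pred_def .
  qed
  \<comment> \<open>Composition with a selected index requires a measurable map for every natural
    number, so indices beyond the net receive the identity. The selected index is always below N,
    hence the estimator is unchanged.\<close>
  define gs' where "gs' k = (if k < N then gs k else (\<lambda>x. x))" for k
  have gs': "gs' k \<in> restrict_space borel square \<rightarrow>\<^sub>M borel" for k
    unfolding gs'_def using gs id_in_bilipschitz_maps by (cases "k < N") (simp_all only: if_True if_False bilipschitz_maps_measurable)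
  have "(\<lambda>w. gs' (selection n m gs N (fst w)) (snd w)) \<in> sample_space n \<Otimes>\<^sub>M restrict_space borel square \<rightarrow>\<^sub>M borel"
    by (rule measurable_compose_countable[where g="\<lambda>w. selection n m gs N (fst w)"])
       (rule measurable_compose[OF measurable_snd gs'], rule measurable_compose[OF measurable_fst sel])
  then show ?thesis
    unfolding estimators_def gs'_def using selection_minimises(1)[OF N] by (simp add: case_prod_unfold)
qed

text \<open>Each component of each cell mean has squared error at most V: squared bias
  \<open>(4 / m)\<^sup>2\<close>, since f varies by at most \<open>2 * (2 / m)\<close> from the
  center of the cell, plus a variance controlled by the mass bound. The number of cells cancels
  against the area factor of the inverse loss, leaving terms of order \<open>r\<^sup>2\<close>
  only.\<close>

lemma selection_risk:
  assumes p: "p \<in> borel_measurable (restrict_space borel square)"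
    and B: "\<And>x. x \<in> square \<Longrightarrow> p x \<le> B" "0 \<le> B"
    and mn: "m > 0" "n > 0" and N: "N > 0" and gs: "\<And>k. k < N \<Longrightarrow> gs k \<in> bilipschitz_maps"
    and net: "\<And>f. f \<in> bilipschitz_maps \<Longrightarrow> \<exists>k<N. \<forall>a\<in>grid m. norm (gs k (center m a) - f (center m a)) \<le> 2 / m"
    and f: "f \<in> bilipschitz_maps" and r: "1 / m \<le> 60 * r" "0 < r"
    and mass: "\<And>a. a \<in> grid m \<Longrightarrow> \<sigma>\<^sup>2 / 36 \<le> n * r\<^sup>2 * measure (P_X p) (cell m a)"
  shows "inverse_risk p \<sigma> c n (\<lambda>D. gs (selection n m gs N D)) f
     \<le> ennreal ((12288 * B * (57600 + 36 * (1 + \<sigma>\<^sup>2) / \<sigma>\<^sup>2) + 294912000 * B) * r\<^sup>2)"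
proof -
  let ?t = "center m" and ?\<theta> = "\<lambda>D a. cell_mean n (cell m a) D"
  let ?g = "\<lambda>D. gs (selection n m gs N D)"
  let ?E = "\<lambda>a j D. (?\<theta> D a $ j - f (?t a) $ j)\<^sup>2"
  \<comment> \<open>With the factor 1024 of the inverse loss, \<open>6144 = 1024 * 6\<close> and
    \<open>81920 = 1024 * 80\<close>. The 6 comes from the minimum contrast bound, and
    \<open>80 = 64 + 4 * 4\<close> adds the discretisation term of the loss to 4 times the total
    error of the nearest net element, which is
    \<open>m\<^sup>2 * (2 / m)\<^sup>2 = 4\<close>.\<close>
  define c1 where "c1 = 6144 * B / (real m)\<^sup>2"
  define c2 where "c2 = 81920 * B / (real m)\<^sup>2"
  define V where "V = (4 / real m)\<^sup>2 + 36 * (1 + \<sigma>\<^sup>2) * r\<^sup>2 / \<sigma>\<^sup>2"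
  have c12: "0 \<le> c1" "0 \<le> c2" using B(2) by (simp_all add: c1_def c2_def)
  have fm: "measurable_map f" using f by (rule bilipschitz_maps_measurable)
  interpret S: prob_space "sample_law p \<sigma> n f" using fm by (rule prob_space_sample_law)
  obtain k where k: "k < N" "\<forall>a\<in>grid m. norm (gs k (?t a) - f (?t a)) \<le> 2 / m" using net[OF f] by blast
  have near: "(\<Sum>a\<in>grid m. (norm (gs k (?t a) - f (?t a)))\<^sup>2) \<le> 4"
  proof -
    have "(\<Sum>a\<in>grid m. (norm (gs k (?t a) - f (?t a)))\<^sup>2) \<le> (\<Sum>a\<in>grid m. (2 / m)\<^sup>2)"
      using k(2) by (intro sum_mono power_mono) auto
    also have "\<dots> = 4" using mn by (simp add: card_grid power_divide)
    finally show ?thesis .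
  qed
  have loss: "L2_norm_sq (P_X p) (\<lambda>y. quasi_inverse c (?g D) y - the_inv_into square f y)
      \<le> ennreal c1 * (\<Sum>a\<in>grid m. \<Sum>j\<in>UNIV. ennreal (?E a j D)) + ennreal c2" for D
  proof -
    have sel: "selection n m gs N D < N" using N by (rule selection_minimises)
    have "(\<Sum>a\<in>grid m. (norm (?g D (?t a) - f (?t a)))\<^sup>2)
        \<le> 6 * (\<Sum>a\<in>grid m. (norm (?\<theta> D a - f (?t a)))\<^sup>2) + 4 * (\<Sum>a\<in>grid m. (norm (gs k (?t a) - f (?t a)))\<^sup>2)"
      using selection_minimises(2)[OF N k(1), where n=n and m=m and gs=gs and D=D]
      unfolding contrast_def by (rule minimum_contrast_bound)
    then have le: "(\<Sum>a\<in>grid m. (norm (?g D (?t a) - f (?t a)))\<^sup>2) + 64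
        \<le> 6 * (\<Sum>a\<in>grid m. (norm (?\<theta> D a - f (?t a)))\<^sup>2) + 80"
      using near by linarith
    have "L2_norm_sq (P_X p) (\<lambda>y. quasi_inverse c (?g D) y - the_inv_into square f y)
        \<le> ennreal (1024 * B / (real m)\<^sup>2 * ((\<Sum>a\<in>grid m. (norm (?g D (?t a) - f (?t a)))\<^sup>2) + 64))"
      by (rule inverse_loss_le[OF p B mn(1) f gs[OF sel]])
    also have "\<dots> \<le> ennreal (1024 * B / (real m)\<^sup>2 * (6 * (\<Sum>a\<in>grid m. (norm (?\<theta> D a - f (?t a)))\<^sup>2) + 80))"
      using B(2) by (intro ennreal_leI mult_left_mono le) auto
    also have "1024 * B / (real m)\<^sup>2 * (6 * (\<Sum>a\<in>grid m. (norm (?\<theta> D a - f (?t a)))\<^sup>2) + 80)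
        = c1 * (\<Sum>a\<in>grid m. \<Sum>j\<in>UNIV. ?E a j D) + c2"
      by (simp add: c1_def c2_def norm_sq_eq distrib_left)
    also have "ennreal \<dots> = ennreal c1 * (\<Sum>a\<in>grid m. \<Sum>j\<in>UNIV. ennreal (?E a j D)) + ennreal c2"
      using c12 by (simp add: ennreal_plus ennreal_mult sum_nonneg sum_ennreal)
    finally show ?thesis .
  qed
  have Em: "(\<lambda>D. ennreal (?E a j D)) \<in> borel_measurable (sample_law p \<sigma> n f)" for a j
  proof -
    have "(\<lambda>v::real^2. ennreal ((v $ j - f (?t a) $ j)\<^sup>2)) \<in> borel_measurable borel"
      by (intro measurable_compose[OF _ measurable_ennreal] borel_measurable_continuous_onI continuous_intros)
    from measurable_compose[OF cell_mean_measurable this] show ?thesis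
      unfolding cell_def by (simp only: measurable_cong_sets[OF sets_sample_law refl] borel_box_around)
  qed
  have int: "(\<integral>\<^sup>+ D. ennreal (?E a j D) \<partial>sample_law p \<sigma> n f) \<le> ennreal V" if a: "a \<in> grid m" for a j
  proof -
    let ?q = "measure (P_X p) (cell m a)"
    have "0 < \<sigma>\<^sup>2 / 36" using \<sigma>_pos by simp
    then have "0 < n * r\<^sup>2 * ?q" using mass[OF a] by linarith
    then have q: "0 < ?q" using mn r by (simp add: zero_less_mult_iff)
    have fsq: "f x \<in> square" if "x \<in> square" for x
      using bilipschitz_mapsD(1)[OF f] that by (auto simp: bij_betw_def)
    have "(\<integral>\<^sup>+ D. ennreal (?E a j D) \<partial>sample_law p \<sigma> n f) \<le> ennreal ((4 / m)\<^sup>2 + (1 + \<sigma>\<^sup>2) / (n * ?q))"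
    proof (rule cell_mean_mse[OF fm _ _ cell_subset_square[OF a] q mn(2)])
      show "\<bar>f x $ j\<bar> \<le> 1" if "x \<in> square" for x
        using fsq[OF that] by (simp add: mem_square abs_le_iff minus_le_iff)
      show "cell m a \<in> sets borel" unfolding cell_def by (rule borel_box_around)
      show "\<bar>f x $ j - f (?t a) $ j\<bar> \<le> 4 / m" if x: "x \<in> cell m a" for x
      proof -
        have xs: "x \<in> square" using x cell_subset_square[OF a] by blast
        have "\<bar>f x $ j - f (?t a) $ j\<bar> \<le> norm (f x - f (?t a))"
          using component_le_norm_cart[of "f x - f (?t a)" j] by simp
        also have "\<dots> \<le> 2 * norm (x - ?t a)" using bilipschitz_mapsD(2)[OF f xs center_in_square[OF a]] .
        also have "\<dots> \<le> 2 * (2 / m)" by (intro mult_left_mono cell_diameter x) simp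
        finally show ?thesis by simp
      qed
    qed
    \<comment> \<open>This is where the mass bound enters: it reads
      \<open>1 / (n * ?q) \<le> 36 * r\<^sup>2 / \<sigma>\<^sup>2\<close> and so turns the variance
      of a cell mean into a multiple of \<open>r\<^sup>2\<close>.\<close>
    also have "\<dots> \<le> ennreal V"
      unfolding V_def
    proof (intro ennreal_leI add_left_mono)
      have "\<sigma>\<^sup>2 \<le> 36 * r\<^sup>2 * (n * ?q)" using mass[OF a] by (simp add: mult_ac)
      then have "(1 + \<sigma>\<^sup>2) * \<sigma>\<^sup>2 \<le> (1 + \<sigma>\<^sup>2) * (36 * r\<^sup>2 * (n * ?q))" by (intro mult_left_mono) auto
      then show "(1 + \<sigma>\<^sup>2) / (n * ?q) \<le> 36 * (1 + \<sigma>\<^sup>2) * r\<^sup>2 / \<sigma>\<^sup>2"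
        using q mn \<sigma>_pos by (simp add: divide_le_eq le_divide_eq mult_ac)
    qed
    finally show ?thesis .
  qed
  have V0: "0 \<le> V" by (simp add: V_def)
  \<comment> \<open>Passing to the majorant first leaves only finite sums of measurable squared
    errors, which can be integrated term by term.\<close>
  have "inverse_risk p \<sigma> c n ?g f
      \<le> (\<integral>\<^sup>+ D. ennreal c1 * (\<Sum>a\<in>grid m. \<Sum>j\<in>UNIV. ennreal (?E a j D)) + ennreal c2 \<partial>sample_law p \<sigma> n f)"
    unfolding inverse_risk_def by (intro nn_integral_mono loss)
  also have "\<dots> = (\<integral>\<^sup>+ D. ennreal c1 * (\<Sum>a\<in>grid m. \<Sum>j\<in>UNIV. ennreal (?E a j D)) \<partial>sample_law p \<sigma> n f) + ennreal c2"
    by (subst nn_integral_add)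
       (intro borel_measurable_times_ennreal borel_measurable_sum borel_measurable_const Em |
        simp only: nn_integral_const S.emeasure_space_1 mult_1_right)+
  also have "(\<integral>\<^sup>+ D. ennreal c1 * (\<Sum>a\<in>grid m. \<Sum>j\<in>UNIV. ennreal (?E a j D)) \<partial>sample_law p \<sigma> n f)
      = ennreal c1 * (\<integral>\<^sup>+ D. (\<Sum>a\<in>grid m. \<Sum>j\<in>UNIV. ennreal (?E a j D)) \<partial>sample_law p \<sigma> n f)"
    by (intro nn_integral_cmult borel_measurable_sum Em)
  also have "(\<integral>\<^sup>+ D. (\<Sum>a\<in>grid m. \<Sum>j\<in>UNIV. ennreal (?E a j D)) \<partial>sample_law p \<sigma> n f)
      = (\<Sum>a\<in>grid m. \<integral>\<^sup>+ D. (\<Sum>j\<in>UNIV. ennreal (?E a j D)) \<partial>sample_law p \<sigma> n f)"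
    by (intro nn_integral_sum borel_measurable_sum Em)
  also have "\<dots> = (\<Sum>a\<in>grid m. \<Sum>j\<in>UNIV. \<integral>\<^sup>+ D. ennreal (?E a j D) \<partial>sample_law p \<sigma> n f)"
    by (intro sum.cong refl nn_integral_sum Em)
  also have "ennreal c1 * \<dots> + ennreal c2 \<le> ennreal c1 * (\<Sum>a\<in>grid m. \<Sum>j\<in>(UNIV :: 2 set). ennreal V) + ennreal c2"
    by (intro add_right_mono mult_left_mono sum_mono int) auto
  also have "(\<Sum>a\<in>grid m. \<Sum>j\<in>(UNIV :: 2 set). ennreal V) = ennreal (\<Sum>a\<in>grid m. \<Sum>j\<in>(UNIV :: 2 set). V)"
    using V0 by (simp only: sum_ennreal sum_nonneg)
  also have "(\<Sum>a\<in>grid m. \<Sum>j\<in>(UNIV :: 2 set). V) = 2 * (real m)\<^sup>2 * V"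
    by (simp add: card_grid)
  also have "ennreal c1 * ennreal (2 * (real m)\<^sup>2 * V) + ennreal c2 = ennreal (c1 * (2 * (real m)\<^sup>2 * V) + c2)"
    using c12 V0 by (simp add: ennreal_plus ennreal_mult)
  also have "\<dots> \<le> ennreal ((12288 * B * (57600 + 36 * (1 + \<sigma>\<^sup>2) / \<sigma>\<^sup>2) + 294912000 * B) * r\<^sup>2)"
    unfolding c1_def c2_def V_def using B(2) mn r \<sigma>_pos by (intro ennreal_leI risk_bound_constant) auto
  finally show ?thesis .
qed

lemma estimator_from_pilot:
  assumes p: "p \<in> borel_measurable (restrict_space borel square)"
    and B: "\<And>x. x \<in> square \<Longrightarrow> p x \<le> B" "0 \<le> B"
    and n: "n > 0" and r: "0 < r" "3 * r \<le> \<sigma>" "30 * r \<le> 1"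
    and pilot: "\<And>f. f \<in> bilipschitz_maps \<Longrightarrow> Linf_error_prob p \<sigma> n pil f r \<ge> 3/4"
  shows "\<exists>g\<in>estimators n. \<forall>f\<in>bilipschitz_maps. inverse_risk p \<sigma> c n g f
      \<le> ennreal ((12288 * B * (57600 + 36 * (1 + \<sigma>\<^sup>2) / \<sigma>\<^sup>2) + 294912000 * B) * r\<^sup>2)"
proof -
  \<comment> \<open>Rounding down \<open>1 / (30 * r)\<close>, which is at least 1, loses at most a
    factor 2. The half-width \<open>1 / m\<close> thus lies between \<open>30 * r\<close>, so that a
    bump fits into each cell, and \<open>60 * r\<close>, so that the bias stays of order r.\<close>
  define z where "z = 1 / (30 * r)"
  define m where "m = nat \<lfloor>z\<rfloor>"
  have z: "1 \<le> z" using r by (simp add: z_def)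
  then have "1 \<le> \<lfloor>z\<rfloor>" by (simp add: le_floor_iff)
  then have m: "m > 0" "real m \<le> z" "z \<le> 2 * real m" unfolding m_def by linarith+
  have h1: "30 * r \<le> 1 / m" using m r by (simp add: z_def field_simps)
  have h2: "1 / m \<le> 60 * r" using m r by (simp add: z_def field_simps)
  obtain gs :: "nat \<Rightarrow> real^2 \<Rightarrow> real^2" and N :: nat where ex: "N > 0 \<and> (\<forall>k<N. gs k \<in> bilipschitz_maps) \<and>
    (\<forall>f\<in>bilipschitz_maps. \<exists>k<N. \<forall>a\<in>grid m. norm (gs k (center m a) - f (center m a)) \<le> 2 / m)"
    using finite_net[OF m(1)] by (elim exE)
  have net: "N > 0" "\<And>k. k < N \<Longrightarrow> gs k \<in> bilipschitz_maps"
    "\<And>f. f \<in> bilipschitz_maps \<Longrightarrow> \<exists>k<N. \<forall>a\<in>grid m. norm (gs k (center m a) - f (center m a)) \<le> 2 / m"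
    using ex by blast+
  have mass: "\<sigma>\<^sup>2 / 36 \<le> n * r\<^sup>2 * measure (P_X p) (cell m a)" if "a \<in> grid m" for a
    unfolding cell_def
    by (rule cell_mass_lower_bound[OF pilot r(1,2) h1 cell_subset_square[OF that, unfolded cell_def]])
  show ?thesis
  proof (rule bexI, rule ballI)
    show "(\<lambda>D. gs (selection n m gs N D)) \<in> estimators n"
      using net(1,2) by (rule selection_estimator)
    fix f assume "f \<in> bilipschitz_maps"
    from selection_risk[OF p B m(1) n net this h2 r(1) mass]
    show "inverse_risk p \<sigma> c n (\<lambda>D. gs (selection n m gs N D)) f
      \<le> ennreal ((12288 * B * (57600 + 36 * (1 + \<sigma>\<^sup>2) / \<sigma>\<^sup>2) + 294912000 * B) * r\<^sup>2)" .
  qed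
qed

end

section \<open>The pilot's rate and the asymptotic conclusion\<close>

lemma rate_tendsto_0:
  fixes C \<alpha> :: real
  shows "(\<lambda>n. C * real n powr (- 1 / (2 + real DIM(real^2))) * ln (real n) powr \<alpha>) \<longlonglongrightarrow> 0"
proof -
  have "((\<lambda>n. real n powr (- 1 / 4) * ln (real n) powr \<alpha>) \<longlongrightarrow> 0) sequentially"
    by real_asymp
  from tendsto_mult_left[OF this, of C] show ?thesis by (simp add: mult.assoc)
qed

theorem proposition11:
  fixes p :: "real^2 \<Rightarrow> real" and \<sigma> :: real and c :: "real^2"
    and G :: "(real^2 \<Rightarrow> real^2) set"
    and pilot :: "nat \<Rightarrow> (nat \<Rightarrow> (real^2) \<times> (real^2)) \<Rightarrow> real^2 \<Rightarrow> real^2"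
    and C \<alpha> :: real and \<delta> :: "nat \<Rightarrow> real"
  defines "G \<equiv> FL_INV \<inter> FL (2 powr (1/4))"
  assumes "p \<in> borel_measurable (restrict_space borel square)"
    and "\<forall>x\<in>square. 0 < p x"
    and "\<exists>B. \<forall>x\<in>square. p x \<le> B"
    and "prob_space (P_X p)"
    and "\<sigma> > 0"
    and "c \<notin> square"
    and "\<forall>n. pilot n \<in> estimators n"
    and "\<forall>n. \<forall>D\<in>space (sample_space n). \<forall>x\<in>square. pilot n D x \<in> square"
    and "C > 0" and "\<alpha> > 0"
    and "decseq \<delta>" and "\<delta> \<longlonglongrightarrow> 0"
    and "\<forall>\<^sub>F n in sequentially. \<forall>f\<in>G.
           Linf_error_prob p \<sigma> n (pilot n) f
             (C * real n powr (- 1 / (2 + real DIM(real^2))) * ln (real n) powr \<alpha>) \<ge> 1 - \<delta> n"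
  shows "\<forall>\<beta>>0. \<exists>Cbar>0. \<forall>\<^sub>F n in sequentially.
           (INF g\<in>estimators n. SUP f\<in>G. inverse_risk p \<sigma> c n g f)
             \<le> ennreal (Cbar * real n powr (- 2 / (2 + real DIM(real^2)))
                          * ln (real n) powr (2 * \<alpha> + 2 * \<beta>))"
proof (intro allI impI)
  fix \<beta> :: real assume \<beta>: "\<beta> > 0"
  interpret regression_model p \<sigma> by (rule regression_model.intro) fact+
  obtain B0 where B0: "\<And>x. x \<in> square \<Longrightarrow> p x \<le> B0" using assms(4) by blast
  \<comment> \<open>The maximum with 1 makes the sign of the bound explicit, as needed for
    \<open>0 \<le> B\<close> and \<open>K > 0\<close>.\<close>
  define B where "B = max B0 1"
  have B: "p x \<le> B" if "x \<in> square" for x using B0[OF that] by (simp add: B_def)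
  have B1: "1 \<le> B" by (simp add: B_def)
  define K where "K = 12288 * B * (57600 + 36 * (1 + \<sigma>\<^sup>2) / \<sigma>\<^sup>2) + 294912000 * B"
  have K: "K > 0" unfolding K_def using B1 \<sigma>_pos by (intro add_nonneg_pos mult_nonneg_nonneg add_nonneg_nonneg) auto
  define r where "r n = C * real n powr (- 1 / (2 + real DIM(real^2))) * ln (real n) powr \<alpha>" for n
  have r0: "r \<longlonglongrightarrow> 0" unfolding r_def by (rule rate_tendsto_0)
  \<comment> \<open>These thresholds give \<open>3 * r n \<le> \<sigma>\<close> and
    \<open>30 * r n \<le> 1\<close>: the bump is small against the noise, and at least one cell fits
    into the square.\<close>
  have "0 < min (\<sigma> / 3) (1 / 30)" using \<sigma>_pos by simp
  with r0 have "\<forall>\<^sub>F n in sequentially. r n < min (\<sigma> / 3) (1 / 30)" by (rule order_tendstoD)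
  moreover have "\<forall>\<^sub>F n in sequentially. \<delta> n < 1/4" using assms(13) by (rule order_tendstoD) simp
  moreover have "\<forall>\<^sub>F n in sequentially. \<forall>f\<in>G. Linf_error_prob p \<sigma> n (pilot n) f (r n) \<ge> 1 - \<delta> n"
    unfolding r_def by (rule assms(14))
  moreover have "\<forall>\<^sub>F n in sequentially. n \<ge> 3" by (rule eventually_ge_at_top)
  ultimately have ev: "\<forall>\<^sub>F n in sequentially. (INF g\<in>estimators n. SUP f\<in>G. inverse_risk p \<sigma> c n g f)
     \<le> ennreal (K * C\<^sup>2 * real n powr (- 2 / (2 + real DIM(real^2))) * ln (real n) powr (2 * \<alpha> + 2 * \<beta>))"
  proof eventually_elim
    case (elim n)
    \<comment> \<open>Since \<open>3 \<ge> exp 1\<close>, the logarithm is at least 1. This makes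
      \<open>r n\<close> positive and its powers monotone in the exponent, so the exponent
      \<open>2 * \<alpha>\<close> of the squared rate may be raised by
      \<open>2 * \<beta>\<close>.\<close>
    have ln: "1 \<le> ln (real n)"
    proof -
      have "exp 1 \<le> real n" by (rule order_trans[OF exp_le]) (use elim(4) in simp)
      then show ?thesis using elim(4) by (simp add: ln_ge_iff)
    qed
    have rn: "0 < r n" unfolding r_def using \<open>C > 0\<close> ln elim(4) by simp
    have pil: "Linf_error_prob p \<sigma> n (pilot n) f (r n) \<ge> 3/4" if "f \<in> bilipschitz_maps" for f
      using elim(2) bspec[OF elim(3), of f] that unfolding G_def by linarith
    have n: "n > 0" using elim(4) by simp
    have r: "3 * r n \<le> \<sigma>" "30 * r n \<le> 1" using elim(1) by simp_all
    have B_nonneg: "0 \<le> B" using B1 by simp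
    obtain g where g: "g \<in> estimators n" "\<And>f. f \<in> bilipschitz_maps \<Longrightarrow> inverse_risk p \<sigma> c n g f \<le> ennreal (K * (r n)\<^sup>2)"
      using estimator_from_pilot[OF assms(2) B B_nonneg n rn r pil, of c] unfolding K_def by blast
    have "(INF g\<in>estimators n. SUP f\<in>G. inverse_risk p \<sigma> c n g f) \<le> (SUP f\<in>G. inverse_risk p \<sigma> c n g f)"
      using g(1) by (rule INF_lower)
    also have "\<dots> \<le> ennreal (K * (r n)\<^sup>2)" using g(2) unfolding G_def by (rule SUP_least)
    also have "\<dots> \<le> ennreal (K * C\<^sup>2 * real n powr (- 2 / (2 + real DIM(real^2))) * ln (real n) powr (2 * \<alpha> + 2 * \<beta>))"
    proof (rule ennreal_leI)
      have sq: "(x powr a)\<^sup>2 = x powr (2 * a)" if "0 < x" for x a :: real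
        using that by (simp add: power2_eq_square powr_add[symmetric])
      have e: "2 * (- 1 / (2 + real DIM(real^2))) = - 2 / (2 + real DIM(real^2))" by simp
      have s1: "(real n powr (- 1 / (2 + real DIM(real^2))))\<^sup>2 = real n powr (- 2 / (2 + real DIM(real^2)))"
        unfolding e[symmetric] by (rule sq) (use n in simp)
      have s2: "(ln (real n) powr \<alpha>)\<^sup>2 = ln (real n) powr (2 * \<alpha>)"
        by (rule sq) (use ln in simp)
      have "(r n)\<^sup>2 = C\<^sup>2 * real n powr (- 2 / (2 + real DIM(real^2))) * ln (real n) powr (2 * \<alpha>)"
        unfolding r_def power_mult_distrib s1 s2 ..
      then have "K * (r n)\<^sup>2 = K * C\<^sup>2 * real n powr (- 2 / (2 + real DIM(real^2))) * ln (real n) powr (2 * \<alpha>)"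
        by (simp only: mult.assoc)
      also have "\<dots> \<le> K * C\<^sup>2 * real n powr (- 2 / (2 + real DIM(real^2))) * ln (real n) powr (2 * \<alpha> + 2 * \<beta>)"
        using K ln \<beta> by (intro mult_left_mono powr_mono) auto
      finally show "K * (r n)\<^sup>2 \<le> K * C\<^sup>2 * real n powr (- 2 / (2 + real DIM(real^2))) * ln (real n) powr (2 * \<alpha> + 2 * \<beta>)" .
    qed
    finally show ?case .
  qed
  have "0 < K * C\<^sup>2" using K \<open>C > 0\<close> by simp
  with ev show "\<exists>Cbar>0. \<forall>\<^sub>F n in sequentially.
           (INF g\<in>estimators n. SUP f\<in>G. inverse_risk p \<sigma> c n g f)
             \<le> ennreal (Cbar * real n powr (- 2 / (2 + real DIM(real^2)))
                          * ln (real n) powr (2 * \<alpha> + 2 * \<beta>))"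
    by (intro exI[of _ "K * C\<^sup>2"] conjI)
qed

end
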